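(* Let $\lambda>0$ and $\omega\in[0,1)$. If $LR(\alpha)$ holds for the Fibonacci XY chain with coupling $\lambda$ and phase $\omega$, then $\alpha\ge\alpha_u^+(\lambda)$.
   Context: Fix $\lambda>0$, $\omega\in[0,1)$, and let $\phi=\frac{1+\sqrt5}{2}$. The Fibonacci field is $V_j=\lambda\,\chi_{[1-\phi^{-1},1)}(j\phi^{-1}+\omega \bmod 1)$, $j\ge1$. For $n\ge1$ let $\mathcal H_n=\bigotimes_{j=1}^n\mathbb C^2$ and $$H_n^{XY}=-\sum_{j=1}^{n-1}(\sigma^x_j\sigma^x_{j+1}+\sigma^y_j\sigma^y_{j+1})+\sum_{j=1}^n V_j\sigma^z_j,$$ where $\sigma^{x,y,z}$ are the Pauli matrices and $\sigma^{x,y,z}_j$ acts as that matrix on the $j$-th factor and as the identity elsewhere. For $J\subset\{1,\dots,n\}$, $\mathcal A_J=\bigotimes_{j\in J}\mathcal B(\mathbb C^2)$, embedded in $\mathcal B(\mathcal H_n)$ by tensoring with identities; $\mathcal A_j=\mathcal A_{\{j\}}$. The Heisenberg dynamics is $\tau_t^n(A)=e^{itH_n^{XY}}Ae^{-itH_n^{XY}}$. "$LR(\alpha)$ holds" means: there exist constants $C_0,\mu>0$, $v\ge0$ such that for all $n$, all $1\le j<j'\le n$, all $t>0$, all $A\in\mathcal A_j$, $B\in\mathcal A_{\{j',\dots,n\}}$: $\|[\tau_t^n(A),B]\|\le C_0\|A\|\|B\|e^{-\mu(|j'-j|-vt^\alpha)}$. The half-line Fibonacci Hamiltonian $H=H(\omega)$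 on $\ell^2(\mathbb Z_+)$ (basis $\{\delta_l\}_{l\ge1}$) is $(Hu)(m)=u(m+1)+u(m-1)+V_m u(m)$ with $u(0)=0$. Define $P(N,t)=\sum_{m>N}|\langle\delta_1,e^{-itH}\delta_m\rangle|^2$, $S^+(\alpha)=-\limsup_{t\to\infty}\frac{\log P(t^\alpha-1,t)}{\log t}$, and $\alpha_u^+(\lambda)=\sup\{\alpha\ge0:S^+(\alpha)<\infty\}$ (computed for $H(\omega)$). *)

theory Defs
  imports "HOL-Analysis.Analysis"
begin

definition phi :: real where "phi = (1 + sqrt 5) / 2"

definition fibV :: "real \<Rightarrow> real \<Rightarrow> nat \<Rightarrow> real" where
  "fibV lam om j = (let x = frac (real j / phi + om) in
      if 1 - 1 / phi \<le> x \<and> x < 1 then lam else 0)"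

text \<open>Basis vectors of (C^2)^{\<otimes> n} are indexed by spin configurations
  s :: nat \<Rightarrow> bool supported in {1..n}; False / True are the first / second
  basis vector of C^2. Operators are matrices indexed by configurations.\<close>

type_synonym config = "nat \<Rightarrow> bool"
type_synonym op = "config \<Rightarrow> config \<Rightarrow> complex"

definition configs :: "nat \<Rightarrow> config set" where
  "configs n = {s. \<forall>k. s k \<longrightarrow> k \<in> {1..n}}"

definition mm :: "nat \<Rightarrow> op \<Rightarrow> op \<Rightarrow> op" where
  "mm n A B = (\<lambda>x y. \<Sum>z\<in>configs n. A x z * B z y)"

definition madd :: "op \<Rightarrow> op \<Rightarrow> op" where
  "madd A B = (\<lambda>x y. A x y + B x y)"

definition msub :: "op \<Rightarrow> op \<Rightarrow> op" where
  "msub A B = (\<lambda>x y. A x y - B x y)"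

definition msmul :: "complex \<Rightarrow> op \<Rightarrow> op" where
  "msmul c A = (\<lambda>x y. c * A x y)"

definition mid :: op where
  "mid = (\<lambda>x y. if x = y then 1 else 0)"

fun mpow :: "nat \<Rightarrow> nat \<Rightarrow> op \<Rightarrow> op" where
  "mpow n 0 A = mid"
| "mpow n (Suc k) A = mm n (mpow n k A) A"

definition mexp :: "nat \<Rightarrow> op \<Rightarrow> op" where
  "mexp n A = (\<lambda>x y. \<Sum>k. mpow n k A x y / of_nat (fact k))"

definition mv :: "nat \<Rightarrow> op \<Rightarrow> (config \<Rightarrow> complex) \<Rightarrow> (config \<Rightarrow> complex)" where
  "mv n A v = (\<lambda>x. \<Sum>y\<in>configs n. A x y * v y)"

definition vnorm :: "nat \<Rightarrow> (config \<Rightarrow> complex) \<Rightarrow> real" where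
  "vnorm n v = sqrt (\<Sum>x\<in>configs n. (cmod (v x))\<^sup>2)"

definition opnorm :: "nat \<Rightarrow> op \<Rightarrow> real" where
  "opnorm n A = Sup {vnorm n (mv n A v) | v. vnorm n v \<le> 1}"

definition restr :: "nat set \<Rightarrow> config \<Rightarrow> config" where
  "restr J s = (\<lambda>k. if k \<in> J then s k else False)"

text \<open>Embedding of an operator b on the sites J (tensored with identities elsewhere).\<close>
definition emb :: "nat set \<Rightarrow> op \<Rightarrow> op" where
  "emb J b = (\<lambda>x y. if (\<forall>k. k \<notin> J \<longrightarrow> x k = y k)
                     then b (restr J x) (restr J y) else 0)"

definition alg :: "nat set \<Rightarrow> op set" where
  "alg J = {emb J b | b. True}"

text \<open>Pauli matrices: 0 = x, 1 = y, 2 = z.\<close>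
definition pauli :: "nat \<Rightarrow> bool \<Rightarrow> bool \<Rightarrow> complex" where
  "pauli a r c =
     (if a = 0 then (if r \<noteq> c then 1 else 0)
      else if a = 1 then (if \<not> r \<and> c then - \<i> else if r \<and> \<not> c then \<i> else 0)
      else (if r = c then (if r then -1 else 1) else 0))"

definition sigma :: "nat \<Rightarrow> nat \<Rightarrow> op" where
  "sigma a j = emb {j} (\<lambda>x y. pauli a (x j) (y j))"

definition HXY :: "real \<Rightarrow> real \<Rightarrow> nat \<Rightarrow> op" where
  "HXY lam om n = (\<lambda>x y.
      - (\<Sum>j\<in>{1..<n}. mm n (sigma 0 j) (sigma 0 (j+1)) x y
                       + mm n (sigma 1 j) (sigma 1 (j+1)) x y)
      + (\<Sum>j\<in>{1..n}. complex_of_real (fibV lam om j) * sigma 2 j x y))"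

definition tau :: "real \<Rightarrow> real \<Rightarrow> nat \<Rightarrow> real \<Rightarrow> op \<Rightarrow> op" where
  "tau lam om n t A =
     mm n (mm n (mexp n (msmul (\<i> * of_real t) (HXY lam om n))) A)
          (mexp n (msmul (- \<i> * of_real t) (HXY lam om n)))"

definition LR :: "real \<Rightarrow> real \<Rightarrow> real \<Rightarrow> bool" where
  "LR lam om \<alpha> \<longleftrightarrow>
     (\<exists>C0 \<mu> v. C0 > 0 \<and> \<mu> > 0 \<and> v \<ge> 0 \<and>
       (\<forall>n j j' t A B. 1 \<le> j \<and> j < j' \<and> j' \<le> n \<and> t > 0 \<and>
          A \<in> alg {j} \<and> B \<in> alg {j'..n} \<longrightarrow>
          opnorm n (msub (mm n (tau lam om n t A) B) (mm n B (tau lam om n t A)))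
            \<le> C0 * opnorm n A * opnorm n B
               * exp (- \<mu> * (real j' - real j - v * t powr \<alpha>))))"

definition Hent :: "real \<Rightarrow> real \<Rightarrow> nat \<Rightarrow> nat \<Rightarrow> real" where
  "Hent lam om l m =
     (if l = 0 \<or> m = 0 then 0
      else if l = m then fibV lam om l
      else if l = m + 1 \<or> m = l + 1 then 1 else 0)"

text \<open>Entries of H^k (H is tridiagonal, so the sum is finite).\<close>
fun Hpow :: "real \<Rightarrow> real \<Rightarrow> nat \<Rightarrow> nat \<Rightarrow> nat \<Rightarrow> real" where
  "Hpow lam om 0 l m = (if l = m then 1 else 0)"
| "Hpow lam om (Suc k) l m = (\<Sum>p\<in>{1..m+1}. Hpow lam om k l p * Hent lam om p m)"

text \<open><delta_l, e^{-itH} delta_m> via the (norm-convergent) exponential series of the bounded operator H.\<close>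
definition Uent :: "real \<Rightarrow> real \<Rightarrow> real \<Rightarrow> nat \<Rightarrow> nat \<Rightarrow> complex" where
  "Uent lam om t l m =
     (\<Sum>k. (- \<i> * of_real t) ^ k / of_nat (fact k) * of_real (Hpow lam om k l m))"

definition Pout :: "real \<Rightarrow> real \<Rightarrow> real \<Rightarrow> real \<Rightarrow> real" where
  "Pout lam om N t = (\<Sum>m. if 1 \<le> m \<and> real m > N then (cmod (Uent lam om t 1 m))\<^sup>2 else 0)"

definition eln :: "real \<Rightarrow> ereal" where
  "eln x = (if x = 0 then - \<infinity> else ereal (ln x))"

definition Splus :: "real \<Rightarrow> real \<Rightarrow> real \<Rightarrow> ereal" where
  "Splus lam om \<alpha> =
     - Limsup at_top (\<lambda>t. eln (Pout lam om (t powr \<alpha> - 1) t) / ereal (ln t))"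

definition alpha_u_plus :: "real \<Rightarrow> real \<Rightarrow> ereal" where
  "alpha_u_plus lam om = Sup (ereal ` {\<alpha>. \<alpha> \<ge> 0 \<and> Splus lam om \<alpha> < \<infinity>})"

end

theory Submission
  imports Defs
begin

text \<open>Flipping one spin of the all-up state, which is an eigenvector of the XY Hamiltonian, gives a
  particle that moves by twice the half-line operator, up to a constant and a sign. Testing the
  Lieb--Robinson bound on \<open>\<sigma>\<^sup>x\<close> at site 1 and \<open>\<sigma>\<^sup>z\<close> at site \<open>m\<close> therefore bounds the amplitude from
  site 1 to \<open>m\<close> by a multiple of \<open>exp (- \<mu> (m - v t\<^sup>\<alpha>))\<close>. If \<open>\<beta> > max \<alpha> 0\<close>, the probability outside
  \<open>t\<^sup>\<beta>\<close> then decays faster than any power of \<open>t\<close>, so \<open>S\<^sup>+(\<beta>) = \<infinity>\<close>.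

  Since \<open>S\<^sup>+(0)\<close> is finite, it remains to exclude \<open>\<alpha> < 0\<close>, which would localize the dynamics uniformly
  in time. The Green function at \<open>z\<close> would then be at most a multiple of \<open>exp (- \<mu> m) / Im z\<close>.
  The Fibonacci trace map supplies \<open>z\<close> with \<open>Im z\<close> exponentially small in \<open>K\<close> at which the traces of
  the first \<open>K\<close> renormalized transfer matrices stay bounded. By Cayley--Hamilton those matrices
  grow at most exponentially in \<open>K\<close>, and for every phase Rauzy induction writes the transfer
  matrix over some length \<open>P \<ge> 2\<^sup>K\<close> as a product of at most \<open>2 K + 1\<close> of them. So it has norm at most
  \<open>exp (O(K\<^sup>2))\<close>, too small for the Green function to decay like \<open>exp (- \<mu> 2\<^sup>K)\<close>.\<close>

section \<open>Local operators on the spin chain and the one-particle sector\<close>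

definition vac :: config where "vac = (\<lambda>_. False)"

definition flip1 :: "nat \<Rightarrow> config" where "flip1 m = (\<lambda>k. k = m)"

lemma flip1_inject [simp]: "flip1 p = flip1 m \<longleftrightarrow> p = m"
  by (metis flip1_def)

lemma vac_neq_flip1 [simp]: "vac \<noteq> flip1 m"
  by (metis flip1_def vac_def)

lemma vac_in_configs [simp]: "vac \<in> configs n"
  by (simp add: vac_def configs_def)

lemma flip1_in_configs [simp]: "flip1 m \<in> configs n \<longleftrightarrow> 1 \<le> m \<and> m \<le> n"
  by (auto simp: flip1_def configs_def)

lemma configs_upd: "x \<in> configs n \<Longrightarrow> j \<in> {1..n} \<Longrightarrow> x(j := b) \<in> configs n"
  by (auto simp: configs_def)

lemma finite_configs [simp]: "finite (configs n)"
proof -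
  have "configs n = (\<lambda>S k. k \<in> S) ` Pow {1..n}"
  proof (intro equalityI subsetI)
    fix s assume "s \<in> configs n"
    then have "s = (\<lambda>k. k \<in> {k. s k})" "{k. s k} \<in> Pow {1..n}"
      by (auto simp: configs_def)
    then show "s \<in> (\<lambda>S k. k \<in> S) ` Pow {1..n}" by blast
  qed (auto simp: configs_def)
  then show ?thesis by simp
qed

lemma vnorm_nonneg: "0 \<le> vnorm n v"
  by (simp add: vnorm_def sum_nonneg)

lemma vnorm_ge_entry: "x \<in> configs n \<Longrightarrow> cmod (v x) \<le> vnorm n v"
  unfolding vnorm_def
  by (rule real_le_rsqrt) (simp add: member_le_sum[where f = "\<lambda>x. (cmod (v x))\<^sup>2"])

text \<open>\<open>opnorm\<close> is a \<open>Sup\<close> of reals, meaningful only for a set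
  bounded above; absolute row sums give a crude bound for every matrix.\<close>

lemma opnorm_bdd_above: "bdd_above {vnorm n (mv n A v) | v. vnorm n v \<le> 1}"
proof -
  have "vnorm n (mv n A v) \<le> sqrt (\<Sum>x\<in>configs n. (\<Sum>y\<in>configs n. cmod (A x y))\<^sup>2)"
    if "vnorm n v \<le> 1" for v
  proof -
    have "cmod (mv n A v x) \<le> (\<Sum>y\<in>configs n. cmod (A x y))" for x
    proof -
      have "cmod (mv n A v x) \<le> (\<Sum>y\<in>configs n. cmod (A x y * v y))"
        unfolding mv_def by (rule norm_sum)
      also have "\<dots> \<le> (\<Sum>y\<in>configs n. cmod (A x y))"
      proof (rule sum_mono)
        fix y assume "y \<in> configs n"
        then have "cmod (v y) \<le> 1" using vnorm_ge_entry[of y n v] that by linarith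
        then show "cmod (A x y * v y) \<le> cmod (A x y)"
          by (simp add: norm_mult mult_left_le)
      qed
      finally show ?thesis .
    qed
    then show ?thesis unfolding vnorm_def
      by (intro real_sqrt_le_mono sum_mono power_mono) auto
  qed
  then show ?thesis by (intro bdd_aboveI) blast
qed

lemma vnorm_mv_le_opnorm: "vnorm n v \<le> 1 \<Longrightarrow> vnorm n (mv n A v) \<le> opnorm n A"
  unfolding opnorm_def by (rule cSup_upper[OF _ opnorm_bdd_above]) blast

lemma opnorm_nonneg: "0 \<le> opnorm n A"
proof -
  have "vnorm n (\<lambda>_. 0) \<le> 1" by (simp add: vnorm_def)
  from vnorm_mv_le_opnorm[OF this, of A] vnorm_nonneg[of n "mv n A (\<lambda>_. 0)"] show ?thesis
    by linarith
qed

lemma opnorm_le: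
  assumes "\<And>v. vnorm n v \<le> 1 \<Longrightarrow> vnorm n (mv n A v) \<le> c"
  shows "opnorm n A \<le> c"
  unfolding opnorm_def
proof (rule cSup_least)
  have "vnorm n (\<lambda>_. 0) \<le> 1" by (simp add: vnorm_def)
  then show "{vnorm n (mv n A v) | v. vnorm n v \<le> 1} \<noteq> {}" by blast
qed (use assms in blast)

lemma opnorm_ge_entry:
  assumes "x \<in> configs n" "y \<in> configs n"
  shows "cmod (A x y) \<le> opnorm n A"
proof -
  let ?v = "\<lambda>z. if z = y then 1 else 0 :: complex"
  have "(\<Sum>z\<in>configs n. (cmod (?v z))\<^sup>2) = (\<Sum>z\<in>configs n. if z = y then 1 else 0)"
    by (rule sum.cong) auto
  then have "vnorm n ?v \<le> 1"
    using assms by (simp add: vnorm_def)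
  moreover have "mv n A ?v x = A x y"
    using assms by (simp add: mv_def if_distrib cong: if_cong)
  ultimately show ?thesis
    using vnorm_ge_entry[OF assms(1), of "mv n A ?v"] vnorm_mv_le_opnorm[of n ?v A] by simp
qed

section \<open>Matrix entries of the Pauli operators and of the XY Hamiltonian\<close>

lemma sigma_entry:
  "sigma a j x y = (if \<forall>k. k \<noteq> j \<longrightarrow> x k = y k then pauli a (x j) (y j) else 0)"
  by (auto simp: sigma_def emb_def restr_def)

text \<open>Only one intermediate configuration contributes, \<open>x\<close> with its spin at
  \<open>j\<close> replaced by that of \<open>y\<close>: the first factor changes only site
  \<open>j\<close>, the second only \<open>j'\<close>.\<close>

lemma mm_sigma:
  assumes "j \<noteq> j'" "j \<in> {1..n}" "x \<in> configs n"
  shows "mm n (sigma a j) (sigma b j') x y =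
    (if \<forall>k. k \<noteq> j \<and> k \<noteq> j' \<longrightarrow> x k = y k
     then pauli a (x j) (y j) * pauli b (x j') (y j') else 0)"
proof -
  let ?r = "if \<forall>k. k \<noteq> j \<and> k \<noteq> j' \<longrightarrow> x k = y k
     then pauli a (x j) (y j) * pauli b (x j') (y j') else 0"
  let ?r' = "if \<forall>k. k \<noteq> j \<and> k \<noteq> j' \<longrightarrow> x k = y k then pauli b (x j') (y j') else 0"
  have "sigma a j x z * sigma b j' z y = (if z = x(j := y j) then ?r else 0)" for z
  proof (cases "z = x(j := y j)")
    case True
    then have z: "z j = y j" "\<And>k. k \<noteq> j \<Longrightarrow> z k = x k" by auto
    have "(\<forall>k. k \<noteq> j' \<longrightarrow> z k = y k) \<longleftrightarrow> (\<forall>k. k \<noteq> j \<and> k \<noteq> j' \<longrightarrow> x k = y k)"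
      using z by metis
    then have "sigma b j' z y = ?r'"
      using z(2)[of j'] assms(1) by (simp only: sigma_entry)
    moreover have "sigma a j x z = pauli a (x j) (y j)"
      using z by (simp add: sigma_entry)
    ultimately show ?thesis unfolding if_P[OF True] by (simp only: if_distrib[of "(*) _"] mult_zero_right)
  next
    case False
    have "\<not> ((\<forall>k. k \<noteq> j \<longrightarrow> x k = z k) \<and> (\<forall>k. k \<noteq> j' \<longrightarrow> z k = y k))"
    proof
      assume *: "(\<forall>k. k \<noteq> j \<longrightarrow> x k = z k) \<and> (\<forall>k. k \<noteq> j' \<longrightarrow> z k = y k)"
      then have "z k = (x(j := y j)) k" for k
        using assms(1) by (cases "k = j") auto
      with False show False by blast
    qed
    then consider "\<not> (\<forall>k. k \<noteq> j \<longrightarrow> x k = z k)" | "\<not> (\<forall>k. k \<noteq> j' \<longrightarrow> z k = y k)"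
      by blast
    then have "sigma a j x z * sigma b j' z y = 0"
      by cases (simp_all only: sigma_entry if_False mult_zero_left mult_zero_right)
    with False show ?thesis by simp
  qed
  then show ?thesis
    using configs_upd[OF assms(3,2), of "y j"] by (simp add: mm_def)
qed

text \<open>The xx and yy terms cancel on parallel neighbours and add up on antiparallel ones, so
  each bond swaps an antiparallel pair with weight 2.\<close>

lemma HXY_entry:
  assumes "x \<in> configs n"
  shows "HXY lam om n x y =
    - (\<Sum>j\<in>{1..<n}. if (\<forall>k. k \<noteq> j \<and> k \<noteq> j+1 \<longrightarrow> x k = y k) \<and>
          x j \<noteq> y j \<and> x (j+1) \<noteq> y (j+1) \<and> x j \<noteq> x (j+1) then 2 else (0::complex))
    + (if x = y then of_real (\<Sum>j\<in>{1..n}. fibV lam om j * (if x j then -1 else 1)) else 0)"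
proof -
  have "mm n (sigma 0 j) (sigma 0 (j+1)) x y + mm n (sigma 1 j) (sigma 1 (j+1)) x y
     = (if (\<forall>k. k \<noteq> j \<and> k \<noteq> j+1 \<longrightarrow> x k = y k) \<and>
          x j \<noteq> y j \<and> x (j+1) \<noteq> y (j+1) \<and> x j \<noteq> x (j+1) then 2 else 0)"
    if "j \<in> {1..<n}" for j
    using that assms by (subst (1 2) mm_sigma) (auto simp: pauli_def)
  moreover have "sigma 2 j x y = (if x = y then (if x j then -1 else 1) else 0)" for j
    by (auto simp: sigma_entry pauli_def fun_eq_iff)
  ultimately show ?thesis
    unfolding HXY_def by (auto intro!: sum.cong)
qed

text \<open>No bond of the all-up state is antiparallel, so only the field term survives.\<close>

lemma HXY_vac:
  "HXY lam om n vac y = (if y = vac then of_real (\<Sum>j\<in>{1..n}. fibV lam om j) else 0)"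
  unfolding HXY_entry[OF vac_in_configs] by (auto simp: vac_def)

text \<open>In the one-particle sector this is the matrix of \<open>E - 2 H\<close>, with
  \<open>E\<close> the sum of all field values. The column vanishes on other configurations, so the
  particle number is conserved.\<close>

lemma HXY_flip1:
  assumes m: "m \<in> {1..n}" and z: "z \<in> configs n"
  shows "HXY lam om n z (flip1 m) =
    (if z = flip1 m then of_real (\<Sum>j\<in>{1..n}. fibV lam om j) - 2 * of_real (Hent lam om m m)
     else if \<exists>p\<in>{1..n}. z = flip1 p \<and> (p = m + 1 \<or> m = p + 1) then - 2 else 0)"
proof -
  let ?hop = "\<lambda>j. (\<forall>k. k \<noteq> j \<and> k \<noteq> j+1 \<longrightarrow> z k = (k = m)) \<and>
          z j \<noteq> (j = m) \<and> z (j+1) \<noteq> (j+1 = m) \<and> z j \<noteq> z (j+1)"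
  \<comment> \<open>Bond \<open>j\<close> moves the particle either to the right from
    \<open>m = j\<close> or to the left from \<open>m = j + 1\<close>.\<close>
  have hop: "?hop j \<longleftrightarrow> (z = flip1 (m+1) \<and> j = m) \<or> (z = flip1 j \<and> m = j + 1)" for j
    unfolding flip1_def fun_eq_iff by (smt (verit) add_left_cancel n_not_Suc_n add.commute plus_1_eq_Suc)
  have S: "(\<Sum>j\<in>{1..<n}. if ?hop j then 2 else (0::complex)) =
     (if \<exists>p\<in>{1..n}. z = flip1 p \<and> (p = m + 1 \<or> m = p + 1) then 2 else 0)"
  proof (cases "\<exists>p\<in>{1..n}. z = flip1 p \<and> (p = m + 1 \<or> m = p + 1)")
    case True
    then obtain p where p: "p \<in> {1..n}" "z = flip1 p" "p = m + 1 \<or> m = p + 1" by blast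
    \<comment> \<open>The bond joining \<open>p\<close> and \<open>m\<close> is numbered by its
      smaller site.\<close>
    have "(if ?hop j then 2 else (0::complex)) = (if j = min p m then 2 else 0)" for j
      unfolding hop using p by auto
    then show ?thesis using True p m by auto
  next
    case False
    then have "(\<Sum>j\<in>{1..<n}. if (z = flip1 (m+1) \<and> j = m) \<or> (z = flip1 j \<and> m = j + 1)
        then 2 else (0::complex)) = 0"
      by (intro sum.neutral) fastforce
    then show ?thesis unfolding hop using False by simp
  qed
  have "(\<Sum>j\<in>{1..n}. fibV lam om j * (if j = m then -1 else 1)) =
    (\<Sum>j\<in>{1..n}. fibV lam om j - (if j = m then 2 * fibV lam om j else 0))"
    by (rule sum.cong) auto
  also have "\<dots> = (\<Sum>j\<in>{1..n}. fibV lam om j) - 2 * Hent lam om m m"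
    using m by (simp add: sum_subtractf Hent_def)
  finally have D: "(\<Sum>j\<in>{1..n}. fibV lam om j * (if j = m then -1 else 1)) =
    (\<Sum>j\<in>{1..n}. fibV lam om j) - 2 * Hent lam om m m" .
  show ?thesis
  proof (cases "z = flip1 m")
    case True
    then show ?thesis
      unfolding HXY_entry[OF z] using D S True by (auto simp: flip1_def)
  next
    case False
    then show ?thesis
      unfolding HXY_entry[OF z] using S by (auto simp: flip1_def)
  qed
qed

text \<open>The identity on the sites of \<open>J\<close> other than \<open>j\<close> has to be
  built into the local matrix.\<close>

lemma sigma_in_alg:
  assumes "j \<in> J"
  shows "sigma a j \<in> alg J"
proof -
  have "sigma a j = emb J (\<lambda>x y. if \<forall>k. k \<noteq> j \<longrightarrow> x k = y k then pauli a (x j) (y j) else 0)"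
  proof (intro ext)
    fix x y
    have "(\<forall>k. k \<noteq> j \<longrightarrow> x k = y k) \<longleftrightarrow>
      (\<forall>k. k \<notin> J \<longrightarrow> x k = y k) \<and> (\<forall>k. k \<noteq> j \<longrightarrow> restr J x k = restr J y k)"
      using assms by (auto simp: restr_def)
    moreover have "restr J x j = x j" "restr J y j = y j"
      using assms by (simp_all add: restr_def)
    moreover have "(if P then p else 0) = (if Q then if R then p else 0 else 0)"
      if "P \<longleftrightarrow> Q \<and> R" for P Q R and p :: complex
      using that by simp
    ultimately show "sigma a j x y =
      emb J (\<lambda>x y. if \<forall>k. k \<noteq> j \<longrightarrow> x k = y k then pauli a (x j) (y j) else 0) x y"
      unfolding sigma_entry emb_def by presburger
  qed
  then show ?thesis unfolding alg_def by blast
qed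

lemma mv_sigma_x:
  assumes "j \<in> {1..n}" "x \<in> configs n"
  shows "mv n (sigma 0 j) v x = v (x(j := \<not> x j))"
proof -
  have "sigma 0 j x y * v y = (if y = x(j := \<not> x j) then v y else 0)" for y
  proof -
    have "(\<forall>k. k \<noteq> j \<longrightarrow> x k = y k) \<and> x j \<noteq> y j \<longleftrightarrow> y = x(j := \<not> x j)"
      by (auto simp: fun_eq_iff)
    moreover have "pauli 0 (x j) (y j) = (if x j \<noteq> y j then 1 else 0)"
      by (simp add: pauli_def)
    ultimately have "sigma 0 j x y = (if y = x(j := \<not> x j) then 1 else 0)"
      unfolding sigma_entry by (smt (verit))
    then show ?thesis by simp
  qed
  then show ?thesis
    using configs_upd[OF assms(2,1), of "\<not> x j"] by (simp add: mv_def)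
qed

lemma opnorm_sigma_x:
  assumes "j \<in> {1..n}"
  shows "opnorm n (sigma 0 j) \<le> 1"
proof (rule opnorm_le)
  fix v assume v: "vnorm n v \<le> 1"
  have "(\<Sum>x\<in>configs n. (cmod (mv n (sigma 0 j) v x))\<^sup>2) =
    (\<Sum>x\<in>configs n. (cmod (v (x(j := \<not> x j))))\<^sup>2)"
    by (rule sum.cong) (simp_all add: mv_sigma_x[OF assms])
  also have "\<dots> = (\<Sum>x\<in>configs n. (cmod (v x))\<^sup>2)"
    by (rule sum.reindex_bij_witness[where i = "\<lambda>x. x(j := \<not> x j)" and j = "\<lambda>x. x(j := \<not> x j)"])
      (use configs_upd assms in auto)
  finally show "vnorm n (mv n (sigma 0 j) v) \<le> 1"
    using v by (simp add: vnorm_def)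
qed

lemma sigma_z_entry: "sigma 2 j x y = (if x = y then (if x j then -1 else 1) else 0)"
  by (auto simp: sigma_entry pauli_def fun_eq_iff)

lemma opnorm_sigma_z: "opnorm n (sigma 2 j) \<le> 1"
proof (rule opnorm_le)
  fix v assume v: "vnorm n v \<le> 1"
  have "mv n (sigma 2 j) v x = (if x j then -1 else 1) * v x" if "x \<in> configs n" for x
    using that by (simp add: mv_def sigma_z_entry if_distrib[where f = "\<lambda>u. u * _"] cong: if_cong)
  then have "(\<Sum>x\<in>configs n. (cmod (mv n (sigma 2 j) v x))\<^sup>2) = (\<Sum>x\<in>configs n. (cmod (v x))\<^sup>2)"
    by (intro sum.cong) (auto simp: norm_mult)
  then show "vnorm n (mv n (sigma 2 j) v) \<le> 1"
    using v by (simp add: vnorm_def)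
qed

section \<open>Powers of the Hamiltonian in the zero- and one-particle sectors\<close>

lemma msmul_apply: "msmul c A x y = c * A x y"
  by (simp add: msmul_def)

lemma mpow_HXY_vac:
  assumes "x \<in> configs n"
  shows "mpow n k (msmul c (HXY lam om n)) vac x =
    (if x = vac then (c * of_real (\<Sum>j\<in>{1..n}. fibV lam om j)) ^ k else 0)"
  using assms
proof (induction k arbitrary: x)
  case 0
  then show ?case by (auto simp: mid_def)
next
  case (Suc k)
  have "mpow n (Suc k) (msmul c (HXY lam om n)) vac x =
    (\<Sum>z\<in>configs n. if z = vac then
       (c * of_real (\<Sum>j\<in>{1..n}. fibV lam om j)) ^ k * (c * HXY lam om n vac x) else 0)"
    unfolding mpow.simps mm_def by (rule sum.cong) (simp_all add: Suc.IH msmul_apply)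
  then show ?case by (simp add: HXY_vac mult.commute)
qed

lemma mexp_HXY_vac:
  assumes "x \<in> configs n"
  shows "mexp n (msmul c (HXY lam om n)) vac x =
    (if x = vac then exp (c * of_real (\<Sum>j\<in>{1..n}. fibV lam om j)) else 0)"
  unfolding mexp_def mpow_HXY_vac[OF assms]
  by (auto simp: exp_def scaleR_conv_of_real divide_inverse mult.commute)

text \<open>Row 1 of the powers of the half-line operator cut off to the sites 1 to
  \<open>n\<close>, which is what a chain of length \<open>n\<close> sees.\<close>

fun hpow :: "real \<Rightarrow> real \<Rightarrow> nat \<Rightarrow> nat \<Rightarrow> nat \<Rightarrow> real" where
  "hpow lam om n 0 m = (if m = 1 then 1 else 0)"
| "hpow lam om n (Suc k) m = (\<Sum>p\<in>{1..n}. hpow lam om n k p * Hent lam om p m)"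

text \<open>Pascal's rule, as in the induction step of the binomial theorem for a scalar plus an
  operator; \<open>g i\<close> stands for an entry of the \<open>i\<close>-th power of the
  operator.\<close>

lemma binomial_sum_Suc:
  fixes E :: "'a::comm_ring_1"
  shows "(\<Sum>i\<le>Suc k. of_nat (Suc k choose i) * E ^ (Suc k - i) * g i) =
    E * (\<Sum>i\<le>k. of_nat (k choose i) * E ^ (k - i) * g i)
    + (\<Sum>i\<le>k. of_nat (k choose i) * E ^ (k - i) * g (Suc i))"
proof -
  have "(\<Sum>i\<le>Suc k. of_nat (Suc k choose i) * E ^ (Suc k - i) * g i) =
    E ^ Suc k * g 0 + (\<Sum>i\<le>k. of_nat (Suc k choose Suc i) * E ^ (k - i) * g (Suc i))"
    by (simp add: sum.atMost_Suc_shift del: sum.atMost_Suc)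
  also have "(\<Sum>i\<le>k. of_nat (Suc k choose Suc i) * E ^ (k - i) * g (Suc i)) =
    (\<Sum>i\<le>k. of_nat (k choose i) * E ^ (k - i) * g (Suc i))
    + (\<Sum>i\<le>k. of_nat (k choose Suc i) * E ^ (k - i) * g (Suc i))"
    by (simp add: sum.distrib[symmetric] algebra_simps)
  \<comment> \<open>The top term vanishes because \<open>k choose Suc k = 0\<close>; below it
    \<open>k - i\<close> exceeds \<open>k - Suc i\<close> by exactly one.\<close>
  also have "(\<Sum>i\<le>k. of_nat (k choose Suc i) * E ^ (k - i) * g (Suc i)) =
    (\<Sum>i<k. of_nat (k choose Suc i) * E ^ (k - i) * g (Suc i))"
    by (simp add: lessThan_Suc_atMost[symmetric] binomial_eq_0)
  also have "\<dots> = E * (\<Sum>i<k. of_nat (k choose Suc i) * E ^ (k - Suc i) * g (Suc i))"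
    unfolding sum_distrib_left
  proof (rule sum.cong)
    fix i assume "i \<in> {..<k}"
    then have "E ^ (k - i) = E * E ^ (k - Suc i)"
      by (simp add: Suc_diff_Suc flip: power_Suc)
    then show "of_nat (k choose Suc i) * E ^ (k - i) * g (Suc i) =
      E * (of_nat (k choose Suc i) * E ^ (k - Suc i) * g (Suc i))" by (simp add: ac_simps)
  qed simp
  also have "E ^ Suc k * g 0 = E * (of_nat (k choose 0) * E ^ (k - 0) * g 0)" by simp
  also have "E * (of_nat (k choose 0) * E ^ (k - 0) * g 0) +
    ((\<Sum>i\<le>k. of_nat (k choose i) * E ^ (k - i) * g (Suc i)) +
     E * (\<Sum>i<k. of_nat (k choose Suc i) * E ^ (k - Suc i) * g (Suc i))) =
    E * (\<Sum>i\<le>k. of_nat (k choose i) * E ^ (k - i) * g i)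
    + (\<Sum>i\<le>k. of_nat (k choose i) * E ^ (k - i) * g (Suc i))"
    by (subst sum.atMost_shift) (simp add: algebra_simps)
  finally show ?thesis .
qed

text \<open>The scalar \<open>E\<close> commutes with the truncated one-particle operator, so the
  binomial theorem applies to \<open>E - 2 H\<close>.\<close>

lemma mpow_HXY_flip1:
  assumes "m \<in> {1..n}"
  shows "mpow n k (msmul c (HXY lam om n)) (flip1 1) (flip1 m) =
    (\<Sum>i\<le>k. of_nat (k choose i) * (c * of_real (\<Sum>j\<in>{1..n}. fibV lam om j)) ^ (k - i)
       * ((- 2 * c) ^ i * of_real (hpow lam om n i m)))"
  using assms
proof (induction k arbitrary: m)
  case 0
  then show ?case by (auto simp: mid_def)
next
  case (Suc k)
  define E where "E = complex_of_real (\<Sum>j\<in>{1..n}. fibV lam om j)"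
  define M where "M = mpow n k (msmul c (HXY lam om n)) (flip1 1)"
  define S where "S = (\<lambda>p. \<Sum>i\<le>k. of_nat (k choose i) * (c * E) ^ (k - i)
       * ((- 2 * c) ^ i * of_real (hpow lam om n i p)))"
  have M: "M (flip1 p) = S p" if "p \<in> {1..n}" for p
    using Suc.IH[OF that] by (simp add: M_def S_def E_def)
  have H: "HXY lam om n (flip1 p) (flip1 m) =
     (if p = m then E else 0) - 2 * of_real (Hent lam om p m)" if "p \<in> {1..n}" for p
    using that Suc.prems by (subst HXY_flip1) (auto simp: E_def Hent_def)
  have "mpow n (Suc k) (msmul c (HXY lam om n)) (flip1 1) (flip1 m) =
    (\<Sum>z\<in>configs n. M z * (c * HXY lam om n z (flip1 m)))"
    by (simp add: mm_def M_def msmul_apply)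
  \<comment> \<open>By conservation of the particle number the intermediate sum runs over particle
    positions only.\<close>
  also have "\<dots> = (\<Sum>z\<in>flip1 ` {1..n}. M z * (c * HXY lam om n z (flip1 m)))"
  proof (rule sum.mono_neutral_right)
    show "\<forall>z\<in>configs n - flip1 ` {1..n}. M z * (c * HXY lam om n z (flip1 m)) = 0"
    proof
      fix z assume z: "z \<in> configs n - flip1 ` {1..n}"
      then have "HXY lam om n z (flip1 m) = 0"
        using Suc.prems by (subst HXY_flip1) auto
      then show "M z * (c * HXY lam om n z (flip1 m)) = 0" by simp
    qed
  qed auto
  also have "\<dots> = (\<Sum>p\<in>{1..n}. S p * (c * HXY lam om n (flip1 p) (flip1 m)))"
    by (subst sum.reindex) (auto simp: inj_on_def M intro!: sum.cong)
  also have "\<dots> = (\<Sum>p\<in>{1..n}. (if p = m then c * E * S p else 0)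
       + (- 2 * c) * (S p * of_real (Hent lam om p m)))"
    by (rule sum.cong) (simp_all only: H, auto simp: algebra_simps)
  also have "\<dots> = c * E * S m + (- 2 * c) * (\<Sum>p\<in>{1..n}. S p * of_real (Hent lam om p m))"
    unfolding sum.distrib sum_distrib_left[symmetric] using Suc.prems by simp
  also have "(- 2 * c) * (\<Sum>p\<in>{1..n}. S p * of_real (Hent lam om p m)) =
    (\<Sum>i\<le>k. of_nat (k choose i) * (c * E) ^ (k - i)
       * ((- 2 * c) ^ Suc i * of_real (hpow lam om n (Suc i) m)))"
  proof -
    have "(\<Sum>p\<in>{1..n}. S p * of_real (Hent lam om p m)) =
      (\<Sum>i\<le>k. \<Sum>p\<in>{1..n}. of_nat (k choose i) * (c * E) ^ (k - i)
       * ((- 2 * c) ^ i * of_real (hpow lam om n i p)) * of_real (Hent lam om p m))"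
      unfolding S_def sum_distrib_right by (rule sum.swap)
    also have "\<dots> = (\<Sum>i\<le>k. of_nat (k choose i) * (c * E) ^ (k - i)
       * ((- 2 * c) ^ i * of_real (hpow lam om n (Suc i) m)))"
      by (simp add: sum_distrib_left mult.assoc)
    finally show ?thesis by (simp add: sum_distrib_left ac_simps)
  qed
  also have "c * E * S m + \<dots> = (\<Sum>i\<le>Suc k. of_nat (Suc k choose i) * (c * E) ^ (Suc k - i)
       * ((- 2 * c) ^ i * of_real (hpow lam om n i m)))"
    unfolding S_def by (rule binomial_sum_Suc[symmetric])
  finally show ?case by (simp only: E_def)
qed

section \<open>Convergence of the exponential series and passage to the half-line\<close>

lemma fibV_bound: "\<bar>fibV lam om j\<bar> \<le> \<bar>lam\<bar>"
  by (simp add: fibV_def Let_def)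

lemma sum_Hent_le:
  assumes "finite S"
  shows "(\<Sum>p\<in>S. \<bar>Hent lam om p m\<bar>) \<le> \<bar>lam\<bar> + 2"
proof -
  have "(\<Sum>p\<in>S. \<bar>Hent lam om p m\<bar>) \<le> (\<Sum>p\<in>S. (if p = m then \<bar>lam\<bar> else 0)
      + ((if p = m + 1 then 1 else 0) + (if p = m - 1 then 1 else 0)))"
    by (rule sum_mono) (auto simp: Hent_def fibV_bound)
  also have "\<dots> \<le> \<bar>lam\<bar> + 2"
    using assms by (simp add: sum.distrib)
  finally show ?thesis .
qed

lemma abs_sum_Hent_le:
  assumes "finite S" "\<And>p. \<bar>f p\<bar> \<le> B"
  shows "\<bar>\<Sum>p\<in>S. f p * Hent lam om p m\<bar> \<le> (\<bar>lam\<bar> + 2) * B"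
proof -
  have B: "0 \<le> B" using assms(2)[of undefined] by linarith
  have "\<bar>\<Sum>p\<in>S. f p * Hent lam om p m\<bar> \<le> (\<Sum>p\<in>S. B * \<bar>Hent lam om p m\<bar>)"
    by (rule order_trans[OF sum_abs])
      (auto intro!: sum_mono mult_right_mono simp: abs_mult assms(2))
  also have "\<dots> = B * (\<Sum>p\<in>S. \<bar>Hent lam om p m\<bar>)"
    by (simp add: sum_distrib_left)
  also have "\<dots> \<le> B * (\<bar>lam\<bar> + 2)"
    by (rule mult_left_mono[OF sum_Hent_le[OF assms(1)] B])
  finally show ?thesis by (simp add: mult.commute)
qed

lemma abs_hpow_le: "\<bar>hpow lam om n k m\<bar> \<le> (\<bar>lam\<bar> + 2) ^ k"
proof (induction k arbitrary: m)
  case (Suc k)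
  show ?case using abs_sum_Hent_le[OF finite_atLeastAtMost Suc.IH] by simp
qed auto

lemma abs_Hpow_le: "\<bar>Hpow lam om k l m\<bar> \<le> (\<bar>lam\<bar> + 2) ^ k"
proof (induction k arbitrary: m)
  case (Suc k)
  show ?case unfolding Hpow.simps power_Suc by (rule abs_sum_Hent_le) (auto intro: Suc.IH)
qed auto

lemma Hpow_eq_0: "m > l + k \<Longrightarrow> Hpow lam om k l m = 0"
proof (induction k arbitrary: m)
  case (Suc k)
  have "Hpow lam om k l p * Hent lam om p m = 0" for p
    using Suc.IH[of p] Suc.prems by (cases "p > l + k") (auto simp: Hent_def)
  then show ?case unfolding Hpow.simps by (intro sum.neutral) blast
qed auto

text \<open>A walk of \<open>k\<close> steps from site 1 stays within \<open>k + 1 \<le> n\<close>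
  and does not feel the cut-off.\<close>

lemma hpow_eq_Hpow:
  assumes "k < n" "m \<in> {1..n}"
  shows "hpow lam om n k m = Hpow lam om k 1 m"
  using assms
proof (induction k arbitrary: m)
  case (Suc k)
  have "hpow lam om n (Suc k) m = (\<Sum>p\<in>{1..n}. Hpow lam om k 1 p * Hent lam om p m)"
    using Suc by (auto intro!: sum.cong)
  also have "\<dots> = (\<Sum>p\<in>{1..n} \<inter> {1..m+1}. Hpow lam om k 1 p * Hent lam om p m)"
    by (rule sum.mono_neutral_right) (auto simp: Hent_def)
  also have "\<dots> = (\<Sum>p\<in>{1..m+1}. Hpow lam om k 1 p * Hent lam om p m)"
    using Suc.prems by (intro sum.mono_neutral_left) (auto intro!: Hpow_eq_0)
  finally show ?case by simp
qed auto

lemma summable_exp_bound: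
  fixes w :: "'a::{real_normed_field,banach}"
  assumes "\<And>k. norm (a k) \<le> B ^ k"
  shows "summable (\<lambda>k. norm (w ^ k / of_nat (fact k) * a k))"
proof (rule summable_comparison_test')
  show "summable (\<lambda>k. (norm w * B) ^ k /\<^sub>R fact k)"
    by (rule summable_exp_generic)
  fix k :: nat
  have "norm w ^ k * norm (a k) / fact k \<le> norm w ^ k * B ^ k / fact k"
    by (intro divide_right_mono mult_left_mono assms) auto
  then show "norm (norm (w ^ k / of_nat (fact k) * a k)) \<le> (norm w * B) ^ k /\<^sub>R fact k"
    by (simp add: norm_mult norm_divide norm_power power_mult_distrib divide_inverse norm_inverse ac_simps)
qed

text \<open>The scalar part splits off as a factor: the Cauchy product of the two exponential series
  reproduces the sums of \<open>mpow_HXY_flip1\<close>.\<close>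

lemma mexp_HXY_flip1:
  assumes "m \<in> {1..n}"
  shows "mexp n (msmul c (HXY lam om n)) (flip1 1) (flip1 m) =
    exp (c * of_real (\<Sum>j\<in>{1..n}. fibV lam om j)) *
    (\<Sum>k. (- 2 * c) ^ k / of_nat (fact k) * of_real (hpow lam om n k m))"
proof -
  define E where "E = complex_of_real (\<Sum>j\<in>{1..n}. fibV lam om j)"
  define a where "a = (\<lambda>k. (- 2 * c) ^ k / of_nat (fact k) * complex_of_real (hpow lam om n k m))"
  have "summable (\<lambda>k. norm (a k))"
    unfolding a_def using abs_hpow_le[of lam om n _ m]
    by (intro summable_exp_bound[where B = "\<bar>lam\<bar> + 2"]) simp
  moreover have "summable (\<lambda>k. norm ((c * E) ^ k / fact k))"
    using summable_norm_exp[of "c * E"] by (simp add: scaleR_conv_of_real divide_inverse mult.commute)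
  ultimately have "(\<Sum>k. a k) * (\<Sum>k. (c * E) ^ k / fact k) =
    (\<Sum>k. \<Sum>i\<le>k. a i * ((c * E) ^ (k - i) / fact (k - i)))"
    by (rule Cauchy_product)
  also have "(\<lambda>k. \<Sum>i\<le>k. a i * ((c * E) ^ (k - i) / fact (k - i))) =
    (\<lambda>k. mpow n k (msmul c (HXY lam om n)) (flip1 1) (flip1 m) / of_nat (fact k))"
  proof
    fix k
    have "a i * ((c * E) ^ (k - i) / fact (k - i)) =
      of_nat (k choose i) * (c * E) ^ (k - i) * ((- 2 * c) ^ i * of_real (hpow lam om n i m)) / of_nat (fact k)"
      if "i \<le> k" for i
      using that by (simp add: a_def binomial_fact field_simps)
    then show "(\<Sum>i\<le>k. a i * ((c * E) ^ (k - i) / fact (k - i))) =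
      mpow n k (msmul c (HXY lam om n)) (flip1 1) (flip1 m) / of_nat (fact k)"
      unfolding mpow_HXY_flip1[OF assms] sum_divide_distrib by (simp add: E_def)
  qed
  finally have "mexp n (msmul c (HXY lam om n)) (flip1 1) (flip1 m) =
    (\<Sum>k. a k) * (\<Sum>k. (c * E) ^ k / fact k)"
    by (simp add: mexp_def)
  also have "(\<Sum>k. (c * E) ^ k / fact k) = exp (c * E)"
    by (simp add: exp_def scaleR_conv_of_real divide_inverse mult.commute)
  finally show ?thesis by (simp add: a_def E_def mult.commute)
qed

text \<open>On the left the all-up state yields only a phase, and \<open>sigma 0 1\<close> turns it
  into \<open>flip1 1\<close>. Up to another phase, the remaining factor is the one-particle
  evolution at twice the time.\<close>

lemma cmod_tau_vac_flip1:
  assumes "m \<in> {1..n}"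
  shows "cmod (tau lam om n t (sigma 0 1) vac (flip1 m)) =
    cmod (\<Sum>k. (2 * \<i> * of_real t) ^ k / of_nat (fact k) * of_real (hpow lam om n k m))"
proof -
  let ?E = "\<Sum>j\<in>{1..n}. fibV lam om j"
  let ?e = "mexp n (msmul (\<i> * of_real t) (HXY lam om n))"
  let ?e' = "mexp n (msmul (- \<i> * of_real t) (HXY lam om n))"
  have n: "1 \<le> n" using assms by simp
  have "mm n ?e (sigma 0 1) vac z = exp (\<i> * of_real t * of_real ?E) * sigma 0 1 vac z" for z
  proof -
    have "mm n ?e (sigma 0 1) vac z =
      (\<Sum>x\<in>configs n. if x = vac then exp (\<i> * of_real t * of_real ?E) * sigma 0 1 vac z else 0)"
      unfolding mm_def by (rule sum.cong) (auto simp: mexp_HXY_vac)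
    then show ?thesis by simp
  qed
  moreover have "sigma 0 1 vac z = (if z = flip1 1 then 1 else 0)" for z
    by (auto simp: sigma_entry pauli_def vac_def flip1_def fun_eq_iff)
  ultimately have "tau lam om n t (sigma 0 1) vac (flip1 m) =
    (\<Sum>z\<in>configs n. if z = flip1 1 then exp (\<i> * of_real t * of_real ?E) * ?e' z (flip1 m) else 0)"
    unfolding tau_def mm_def[of n "mm n ?e (sigma 0 1)"] by (intro sum.cong refl) simp_all
  also have "\<dots> = exp (\<i> * of_real t * of_real ?E) * ?e' (flip1 1) (flip1 m)"
    using n by simp
  finally have "cmod (tau lam om n t (sigma 0 1) vac (flip1 m)) = cmod (?e' (flip1 1) (flip1 m))"
    by (simp add: norm_mult norm_exp_eq_Re)
  also have "\<dots> = cmod (\<Sum>k. (- 2 * (- \<i> * of_real t)) ^ k / of_nat (fact k) * of_real (hpow lam om n k m))"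
    unfolding mexp_HXY_flip1[OF assms] by (simp add: norm_mult norm_exp_eq_Re)
  finally show ?thesis by (simp add: mult.assoc)
qed

text \<open>Each term is eventually constant in \<open>n\<close>, and an exponential series
  dominates the terms uniformly in \<open>n\<close>.\<close>

lemma tendsto_hpow_series:
  "(\<lambda>n. \<Sum>k. w ^ k / of_nat (fact k) * complex_of_real (hpow lam om n k m))
     \<longlonglongrightarrow> (\<Sum>k. w ^ k / of_nat (fact k) * complex_of_real (Hpow lam om k 1 m))"
  if "1 \<le> m"
proof -
  define M where "M = (\<lambda>k. norm (w ^ k / of_nat (fact k) * complex_of_real ((\<bar>lam\<bar> + 2) ^ k)))"
  have "summable M"
    unfolding M_def by (rule summable_exp_bound[where B = "\<bar>lam\<bar> + 2"]) (simp add: norm_power)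
  moreover have "(\<lambda>n. w ^ k / of_nat (fact k) * complex_of_real (hpow lam om n k m))
     \<longlonglongrightarrow> w ^ k / of_nat (fact k) * complex_of_real (Hpow lam om k 1 m)" for k
  proof (rule tendsto_eventually)
    show "\<forall>\<^sub>F n in sequentially. w ^ k / of_nat (fact k) * complex_of_real (hpow lam om n k m)
       = w ^ k / of_nat (fact k) * complex_of_real (Hpow lam om k 1 m)"
      using eventually_gt_at_top[of "max k m"]
      by eventually_elim (use that in \<open>simp add: hpow_eq_Hpow\<close>)
  qed
  moreover have "norm (w ^ k / of_nat (fact k) * complex_of_real (hpow lam om n k m)) \<le> M k" for k n
    unfolding M_def norm_mult using abs_hpow_le[of lam om n k m]
    by (intro mult_left_mono) (simp_all add: norm_power)
  then have "\<forall>\<^sub>F (k, n) in sequentially \<times>\<^sub>F sequentially.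
      norm (w ^ k / of_nat (fact k) * complex_of_real (hpow lam om n k m)) \<le> M k"
    by (intro always_eventually) (auto simp only: split: prod.splits)
  ultimately show ?thesis
    by (intro tannerys_theorem[THEN conjunct2, THEN conjunct2]) auto
qed

lemma summable_Uent:
  "summable (\<lambda>k. norm (w ^ k / of_nat (fact k) * complex_of_real (Hpow lam om k l m)))"
  using abs_Hpow_le[of lam om _ l m]
  by (intro summable_exp_bound[where B = "\<bar>lam\<bar> + 2"]) simp

text \<open>The entries of \<open>H\<close> are real, so complex conjugation reverses time. The
  chain produces amplitudes with the opposite sign of time.\<close>

lemma cmod_Uent_minus: "cmod (Uent lam om (- t) l m) = cmod (Uent lam om t l m)"
proof -
  have "(\<lambda>k. (- \<i> * of_real t) ^ k / of_nat (fact k) * of_real (Hpow lam om k l m))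
      sums Uent lam om t l m"
    unfolding Uent_def by (rule summable_sums[OF summable_norm_cancel[OF summable_Uent]])
  then have "(\<lambda>k. cnj ((- \<i> * of_real t) ^ k / of_nat (fact k) * of_real (Hpow lam om k l m)))
      sums cnj (Uent lam om t l m)"
    by (simp only: sums_cnj)
  then have "cnj (Uent lam om t l m) = Uent lam om (- t) l m"
    unfolding Uent_def by (intro sums_unique) simp
  then show ?thesis by (metis complex_mod_cnj)
qed

lemma flip1_apply: "flip1 m k \<longleftrightarrow> k = m"
  by (simp add: flip1_def)

lemma vac_apply: "\<not> vac k"
  by (simp add: vac_def)

text \<open>The commutator of the evolved \<^term>\<open>sigma 0 1\<close> with \<^term>\<open>sigma 2 m\<close> has a one-particle
  amplitude as its entry at \<^term>\<open>vac\<close> and \<^term>\<open>flip1 m\<close>. The hopping strength 2 of the XY chain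
  doubles the time.\<close>
lemma LR_imp_Uent_le:
  assumes "LR lam om \<alpha>"
  obtains C \<mu> v where "C > 0" "\<mu> > 0" "v \<ge> 0"
    "\<And>m t. 2 \<le> m \<Longrightarrow> t > 0 \<Longrightarrow>
       cmod (Uent lam om t 1 m) \<le> C * exp (- \<mu> * (real m - v * t powr \<alpha>))"
proof -
  from assms[unfolded LR_def] obtain C \<mu> v where *: "C > 0 \<and> \<mu> > 0 \<and> v \<ge> 0 \<and>
       (\<forall>n j j' t A B. 1 \<le> j \<and> j < j' \<and> j' \<le> n \<and> t > 0 \<and>
          A \<in> alg {j} \<and> B \<in> alg {j'..n} \<longrightarrow>
          opnorm n (msub (mm n (tau lam om n t A) B) (mm n B (tau lam om n t A)))
            \<le> C * opnorm n A * opnorm n B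
               * exp (- \<mu> * (real j' - real j - v * t powr \<alpha>)))"
    by (elim exE)
  then have C: "C > 0" "\<mu> > 0" "v \<ge> 0" by (simp_all only:)
  note LR = *[THEN conjunct2, THEN conjunct2, THEN conjunct2, rule_format]
  have fin: "cmod (\<Sum>k. (2 * \<i> * of_real t) ^ k / of_nat (fact k) * of_real (hpow lam om n k m))
      \<le> C * exp (- \<mu> * (real m - 1 - v * t powr \<alpha>))"
    if m: "2 \<le> m" "m \<le> n" and t: "t > 0" for m n t
  proof -
    define T where "T = tau lam om n t (sigma 0 1)"
    \<comment> \<open>\<open>sigma 2 m\<close> is diagonal, -1 at \<open>flip1 m\<close> and 1 at
      \<open>vac\<close>, so the two products have opposite signs and add up in the
      commutator.\<close>
    have "mm n T (sigma 2 m) vac (flip1 m) = - T vac (flip1 m)"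
      using m by (simp add: mm_def sigma_z_entry if_distrib flip1_apply cong: if_cong)
    moreover have "mm n (sigma 2 m) T vac (flip1 m) = T vac (flip1 m)"
      using m by (simp add: mm_def sigma_z_entry if_distrib[where f = "\<lambda>u. u * _"] vac_apply cong: if_cong)
    ultimately have "msub (mm n T (sigma 2 m)) (mm n (sigma 2 m) T) vac (flip1 m) = - (2 * T vac (flip1 m))"
      by (simp add: msub_def)
    then have "cmod (msub (mm n T (sigma 2 m)) (mm n (sigma 2 m) T) vac (flip1 m)) = 2 * cmod (T vac (flip1 m))"
      by (simp only: norm_minus_cancel norm_mult norm_numeral)
    then have "2 * cmod (T vac (flip1 m)) \<le> opnorm n (msub (mm n T (sigma 2 m)) (mm n (sigma 2 m) T))"
      using opnorm_ge_entry[of vac n "flip1 m"] m by (metis flip1_in_configs le_trans one_le_numeral vac_in_configs)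
    also have "\<dots> \<le> C * opnorm n (sigma 0 1) * opnorm n (sigma 2 m)
        * exp (- \<mu> * (real m - real 1 - v * t powr \<alpha>))"
      unfolding T_def using m t by (intro LR conjI sigma_in_alg) auto
    also have "\<dots> \<le> C * 1 * 1 * exp (- \<mu> * (real m - real 1 - v * t powr \<alpha>))"
      using C m by (intro mult_right_mono mult_mono opnorm_sigma_x opnorm_sigma_z opnorm_nonneg) auto
    finally have "2 * cmod (T vac (flip1 m)) \<le> C * exp (- \<mu> * (real m - 1 - v * t powr \<alpha>))"
      by simp
    then have "cmod (T vac (flip1 m)) \<le> C * exp (- \<mu> * (real m - 1 - v * t powr \<alpha>))"
      using norm_ge_zero[of "T vac (flip1 m)"] by linarith
    then show ?thesis
      using cmod_tau_vac_flip1[of m n lam om t] m unfolding T_def by simp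
  qed
  have inf: "cmod (Uent lam om (2 * t) 1 m) \<le> C * exp (- \<mu> * (real m - 1 - v * t powr \<alpha>))"
    if m: "2 \<le> m" and t: "t > 0" for m t
  proof -
    have "(\<lambda>n. cmod (\<Sum>k. (2 * \<i> * of_real t) ^ k / of_nat (fact k) * of_real (hpow lam om n k m)))
        \<longlonglongrightarrow> cmod (\<Sum>k. (2 * \<i> * of_real t) ^ k / of_nat (fact k) * of_real (Hpow lam om k 1 m))"
      using m by (intro tendsto_norm tendsto_hpow_series) simp
    then have "cmod (\<Sum>k. (2 * \<i> * of_real t) ^ k / of_nat (fact k) * of_real (Hpow lam om k 1 m))
      \<le> C * exp (- \<mu> * (real m - 1 - v * t powr \<alpha>))"
      by (rule LIMSEQ_le_const2) (use fin m t in blast)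
    moreover have "(\<Sum>k. (2 * \<i> * of_real t) ^ k / of_nat (fact k) * of_real (Hpow lam om k 1 m)) =
      Uent lam om (- (2 * t)) 1 m"
      unfolding Uent_def by (intro suminf_cong) (simp add: mult.assoc mult.left_commute)
    ultimately show ?thesis by (simp only: cmod_Uent_minus)
  qed
  \<comment> \<open>\<open>exp \<mu>\<close> absorbs the distance \<open>m - 1\<close> in place of
    \<open>m\<close>; \<open>(1/2) powr \<alpha>\<close> comes from halving the time.\<close>
  show thesis
  proof (rule that[of "C * exp \<mu>" \<mu> "v * (1/2) powr \<alpha>"])
    fix m :: nat and t :: real assume "2 \<le> m" "t > 0"
    then have "cmod (Uent lam om t 1 m) \<le> C * exp (- \<mu> * (real m - 1 - v * (t / 2) powr \<alpha>))"
      using inf[of m "t/2"] by simp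
    also have "v * (t / 2) powr \<alpha> = v * (1/2) powr \<alpha> * t powr \<alpha>"
      using \<open>t > 0\<close> by (simp add: powr_mult[symmetric])
    also have "C * exp (- \<mu> * (real m - 1 - v * (1/2) powr \<alpha> * t powr \<alpha>)) =
      C * exp \<mu> * exp (- \<mu> * (real m - v * (1/2) powr \<alpha> * t powr \<alpha>))"
      by (simp add: mult.assoc algebra_simps flip: exp_add)
    finally show "cmod (Uent lam om t 1 m)
      \<le> C * exp \<mu> * exp (- \<mu> * (real m - v * (1/2) powr \<alpha> * t powr \<alpha>))" .
  qed (use C in auto)
qed

section \<open>Fast decay of outside probabilities\<close>

text \<open>The squared amplitude decays like \<open>exp (- 2 * \<mu> * m)\<close>. For
  \<open>m > N\<close> half of this rate pays for \<open>exp (- \<mu> * N)\<close>, and the other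
  half leaves a geometric series.\<close>

lemma Pout_le:
  assumes U: "\<And>m t. 2 \<le> m \<Longrightarrow> t > 0 \<Longrightarrow>
       cmod (Uent lam om t 1 m) \<le> C * exp (- \<mu> * (real m - v * t powr \<alpha>))"
    and "\<mu> > 0" "N \<ge> 1" "t > 0"
  shows "0 \<le> Pout lam om N t"
    and "Pout lam om N t \<le> C\<^sup>2 / (1 - exp (- \<mu>)) * exp (2 * \<mu> * v * t powr \<alpha> - \<mu> * N)"
proof -
  define D where "D = C\<^sup>2 * exp (2 * \<mu> * v * t powr \<alpha> - \<mu> * N)"
  define f where "f = (\<lambda>m. if 1 \<le> m \<and> real m > N then (cmod (Uent lam om t 1 m))\<^sup>2 else 0)"
  have q: "norm (exp (- \<mu>)) < 1" using \<open>\<mu> > 0\<close> by simp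
  have f: "0 \<le> f m" "f m \<le> D * exp (- \<mu>) ^ m" for m
  proof -
    show "0 \<le> f m" by (simp add: f_def)
    show "f m \<le> D * exp (- \<mu>) ^ m"
    proof (cases "real m > N")
      case True
      then have "2 \<le> m" using \<open>N \<ge> 1\<close> by linarith
      then have "(cmod (Uent lam om t 1 m))\<^sup>2 \<le> (C * exp (- \<mu> * (real m - v * t powr \<alpha>)))\<^sup>2"
        using U \<open>t > 0\<close> by (intro power_mono) auto
      also have "\<dots> = C\<^sup>2 * exp (2 * (- \<mu> * (real m - v * t powr \<alpha>)))"
        by (simp only: power_mult_distrib exp_double)
      also have "\<dots> \<le> C\<^sup>2 * exp ((2 * \<mu> * v * t powr \<alpha> - \<mu> * N) + real m * (- \<mu>))"
        using True \<open>\<mu> > 0\<close> by (intro mult_left_mono) (simp_all add: algebra_simps)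
      also have "\<dots> = D * exp (- \<mu>) ^ m"
        by (simp only: D_def exp_add exp_of_nat_mult mult.assoc)
      finally show ?thesis by (simp add: f_def D_def)
    qed (simp add: f_def D_def)
  qed
  have g: "(\<lambda>m. D * exp (- \<mu>) ^ m) sums (D * (1 / (1 - exp (- \<mu>))))"
    by (intro sums_mult geometric_sums q)
  have s: "summable f"
    by (rule summable_comparison_test'[OF sums_summable[OF g]]) (use f in auto)
  show "0 \<le> Pout lam om N t"
    unfolding Pout_def f_def[symmetric] using f s by (intro suminf_nonneg) auto
  have "suminf f \<le> D * (1 / (1 - exp (- \<mu>)))"
    using suminf_le[OF f(2) s sums_summable[OF g]] sums_unique[OF g] by simp
  then show "Pout lam om N t \<le> C\<^sup>2 / (1 - exp (- \<mu>)) * exp (2 * \<mu> * v * t powr \<alpha> - \<mu> * N)"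
    unfolding Pout_def f_def[symmetric] by (simp add: D_def)
qed

lemma powr_at_top:
  fixes p :: real
  assumes "p > 0"
  shows "filterlim (\<lambda>t. t powr p) at_top at_top"
proof -
  have "filterlim (\<lambda>t::real. exp (p * ln t)) at_top at_top"
    by (intro filterlim_compose[OF exp_at_top] filterlim_tendsto_pos_mult_at_top[OF tendsto_const]
        ln_at_top assms)
  then show ?thesis
    by (rule filterlim_mono_eventually[OF _ order_refl order_refl])
      (use eventually_gt_at_top[of 0] in eventually_elim, simp add: powr_def)
qed

text \<open>After division by \<open>t powr \<beta>\<close> every term except \<open>c\<close> tends
  to 0, the logarithm included.\<close>

lemma eventually_powr_dominates:
  fixes a b c M \<alpha> \<beta> :: real
  assumes "c > 0" "\<beta> > 0" "\<beta> > \<alpha>"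
  shows "\<forall>\<^sub>F t in at_top. a + b * t powr \<alpha> - c * t powr \<beta> \<le> M * ln t"
proof -
  have top: "filterlim (\<lambda>t::real. t powr \<beta>) at_top at_top"
    using \<open>\<beta> > 0\<close> by (rule powr_at_top)
  have "((\<lambda>t. a * t powr (- \<beta>) + b * t powr (\<alpha> - \<beta>) - (M / \<beta>) * (ln (t powr \<beta>) / t powr \<beta>))
      \<longlongrightarrow> a * 0 + b * 0 - (M / \<beta>) * 0) at_top"
    using assms filterlim_ident
    by (intro tendsto_intros tendsto_neg_powr filterlim_compose[OF ln_x_over_x_tendsto_0 top]) auto
  then have "\<forall>\<^sub>F t in at_top.
      a * t powr (- \<beta>) + b * t powr (\<alpha> - \<beta>) - (M / \<beta>) * (ln (t powr \<beta>) / t powr \<beta>) < c"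
    using \<open>c > 0\<close> by (intro order_tendstoD(2)) auto
  then show ?thesis
    using eventually_gt_at_top[of 0]
  proof eventually_elim
    case (elim t)
    have "(a * t powr (- \<beta>) + b * t powr (\<alpha> - \<beta>) - (M / \<beta>) * (ln (t powr \<beta>) / t powr \<beta>)) * t powr \<beta>
       = a + b * t powr \<alpha> - M * ln t"
      using elim \<open>\<beta> > 0\<close> by (simp add: powr_minus powr_diff field_simps ln_powr)
    moreover have "(a * t powr (- \<beta>) + b * t powr (\<alpha> - \<beta>) - (M / \<beta>) * (ln (t powr \<beta>) / t powr \<beta>)) * t powr \<beta>
       \<le> c * t powr \<beta>"
      using elim by (intro mult_right_mono) auto
    ultimately show ?case by linarith
  qed
qed

text \<open>The logarithm of the bound in \<open>Pout_le\<close> is dominated by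
  \<open>- \<mu> * t powr \<beta>\<close> and falls below \<open>M * ln t\<close> for every
  \<open>M\<close>, however negative.\<close>

lemma Splus_eq_infinity:
  assumes U: "\<And>m t. 2 \<le> m \<Longrightarrow> t > 0 \<Longrightarrow>
       cmod (Uent lam om t 1 m) \<le> C * exp (- \<mu> * (real m - v * t powr \<alpha>))"
    and "C > 0" "\<mu> > 0" "\<beta> > 0" "\<beta> > \<alpha>"
  shows "Splus lam om \<beta> = \<infinity>"
proof -
  let ?P = "\<lambda>t. Pout lam om (t powr \<beta> - 1) t"
  let ?K = "C\<^sup>2 / (1 - exp (- \<mu>))"
  have K: "?K > 0" using assms by simp
  have "Limsup at_top (\<lambda>t. eln (?P t) / ereal (ln t)) \<le> ereal M" for M
  proof (rule Limsup_bounded)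
    have "\<forall>\<^sub>F t in at_top. 2 \<le> t powr \<beta>"
      using powr_at_top[OF \<open>\<beta> > 0\<close>] by (simp add: filterlim_at_top)
    moreover have "\<forall>\<^sub>F t in at_top.
        (ln ?K + \<mu>) + (2 * \<mu> * v) * t powr \<alpha> - \<mu> * t powr \<beta> \<le> M * ln t"
      using assms by (intro eventually_powr_dominates)
    ultimately show "\<forall>\<^sub>F t in at_top. eln (?P t) / ereal (ln t) \<le> ereal M"
      using eventually_gt_at_top[of 1]
    proof eventually_elim
      case (elim t)
      then have P: "0 \<le> ?P t"
          "?P t \<le> ?K * exp (2 * \<mu> * v * t powr \<alpha> - \<mu> * (t powr \<beta> - 1))"
        using Pout_le[OF U \<open>\<mu> > 0\<close>, of "t powr \<beta> - 1" t] by auto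
      show ?case
      proof (cases "?P t = 0")
        \<comment> \<open>Here \<open>eln\<close> is minus infinity, and dividing by
          \<open>ln t > 0\<close> keeps it so.\<close>
        case True
        then show ?thesis using elim by (simp add: eln_def)
      next
        case False
        then have "ln (?P t) \<le> ln (?K * exp (2 * \<mu> * v * t powr \<alpha> - \<mu> * (t powr \<beta> - 1)))"
          using P by (intro ln_mono) auto
        also have "\<dots> = (ln ?K + \<mu>) + (2 * \<mu> * v) * t powr \<alpha> - \<mu> * t powr \<beta>"
          using K by (subst ln_mult) (auto simp: algebra_simps)
        also have "\<dots> \<le> M * ln t" by (rule elim)
        finally show ?thesis using False elim by (simp add: eln_def divide_le_eq)
      qed
    qed
  qed
  then have "Limsup at_top (\<lambda>t. eln (?P t) / ereal (ln t)) = - \<infinity>"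
    by (rule ereal_bot)
  then show ?thesis by (simp add: Splus_def)
qed

section \<open>The trace map\<close>

text \<open>The Fibonacci trace map; \<open>trace_fib\<close> identifies its values with traces. The
  ring is general because real and complex spectral parameters both occur.\<close>

fun fib_trace :: "'a::comm_ring_1 \<Rightarrow> 'a \<Rightarrow> nat \<Rightarrow> 'a" where
  "fib_trace l z 0 = 2"
| "fib_trace l z (Suc 0) = z"
| "fib_trace l z (Suc (Suc 0)) = z - l"
| "fib_trace l z (Suc (Suc (Suc n))) =
     fib_trace l z (Suc (Suc n)) * fib_trace l z (Suc n) - fib_trace l z n"

text \<open>The Fricke-Vogt invariant: a step of the recursion exchanges the two roots of one
  quadratic equation.\<close>

lemma fib_trace_invariant:
  "(fib_trace l z (Suc (Suc n)))\<^sup>2 + (fib_trace l z (Suc n))\<^sup>2 + (fib_trace l z n)\<^sup>2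
     - fib_trace l z (Suc (Suc n)) * fib_trace l z (Suc n) * fib_trace l z n = 4 + l\<^sup>2"
proof (induction n)
  case 0
  show ?case by (simp add: power2_eq_square algebra_simps)
next
  case (Suc n)
  have "(fib_trace l z (Suc (Suc (Suc n))))\<^sup>2 + (fib_trace l z (Suc (Suc n)))\<^sup>2 + (fib_trace l z (Suc n))\<^sup>2
     - fib_trace l z (Suc (Suc (Suc n))) * fib_trace l z (Suc (Suc n)) * fib_trace l z (Suc n) =
    (fib_trace l z (Suc (Suc n)))\<^sup>2 + (fib_trace l z (Suc n))\<^sup>2 + (fib_trace l z n)\<^sup>2
     - fib_trace l z (Suc (Suc n)) * fib_trace l z (Suc n) * fib_trace l z n"
    unfolding fib_trace.simps by (simp add: power2_eq_square algebra_simps)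
  with Suc show ?case by simp
qed

lemma continuous_on_fib_trace: "continuous_on S (\<lambda>z::real. fib_trace l z n)"
proof (induction n rule: less_induct)
  case (less n)
  consider "n = 0" | "n = 1" | "n = 2" | m where "n = Suc (Suc (Suc m))"
    by (metis One_nat_def Suc_1 not0_implies_Suc)
  then show ?case
    by cases (use less in \<open>auto simp: numeral_2_eq_2 intro!: continuous_intros\<close>)
qed

lemma escape_step:
  fixes b c d e :: real
  assumes "\<bar>b\<bar> > 2" "\<bar>c\<bar> > 2" "\<bar>d\<bar> \<ge> \<bar>b\<bar>" "\<bar>d\<bar> \<ge> \<bar>c\<bar>" "e = d * c - b"
  shows "\<bar>d * c\<bar> > \<bar>b\<bar>" "\<bar>e\<bar> \<ge> \<bar>d\<bar>"
proof -
  have "2 * \<bar>d\<bar> \<le> \<bar>d * c\<bar>"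
    using assms mult_left_mono[of 2 "\<bar>c\<bar>" "\<bar>d\<bar>"] by (simp add: abs_mult mult.commute)
  then show "\<bar>d * c\<bar> > \<bar>b\<bar>" "\<bar>e\<bar> \<ge> \<bar>d\<bar>"
    using assms by linarith+
qed

text \<open>Two consecutive values beyond 2 after one within 2 never return: their product is at
  least twice either factor and dominates the subtracted term. So each new sign is the product of
  the two preceding ones, which later locates roots.\<close>

lemma escape:
  fixes y :: "nat \<Rightarrow> real"
  assumes rec: "\<And>n. y (Suc (Suc (Suc n))) = y (Suc (Suc n)) * y (Suc n) - y n"
    and k: "\<bar>y k\<bar> \<le> 2" "\<bar>y (Suc k)\<bar> > 2" "\<bar>y (Suc (Suc k))\<bar> > 2" and "n \<ge> k"
  shows "\<bar>y (Suc n)\<bar> > 2" "sgn (y (Suc (Suc (Suc n)))) = sgn (y (Suc (Suc n))) * sgn (y (Suc n))"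
proof -
  have sg: "sgn (c * b - a) = sgn c * sgn b" if "\<bar>c * b\<bar> > \<bar>a\<bar>" for a b c :: real
  proof -
    have "sgn (c * b - a) = sgn (c * b)" using that by (auto simp: sgn_if)
    then show ?thesis by (simp only: sgn_mult)
  qed
  have inv: "\<bar>y (Suc n)\<bar> > 2 \<and> \<bar>y (Suc (Suc n))\<bar> > 2 \<and> \<bar>y (Suc (Suc (Suc n)))\<bar> \<ge> \<bar>y (Suc n)\<bar>
      \<and> \<bar>y (Suc (Suc (Suc n)))\<bar> \<ge> \<bar>y (Suc (Suc n))\<bar>
      \<and> sgn (y (Suc (Suc (Suc n)))) = sgn (y (Suc (Suc n))) * sgn (y (Suc n))"
    using \<open>n \<ge> k\<close>
  proof (induction n rule: dec_induct)
    case base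
    have "2 * \<bar>y (Suc (Suc k))\<bar> \<le> \<bar>y (Suc (Suc k)) * y (Suc k)\<bar>"
         "2 * \<bar>y (Suc k)\<bar> \<le> \<bar>y (Suc (Suc k)) * y (Suc k)\<bar>"
      using k mult_mono[of 2 "\<bar>y (Suc k)\<bar>" "\<bar>y (Suc (Suc k))\<bar>" "\<bar>y (Suc (Suc k))\<bar>"]
        mult_mono[of 2 "\<bar>y (Suc (Suc k))\<bar>" "\<bar>y (Suc k)\<bar>" "\<bar>y (Suc k)\<bar>"]
      by (simp_all add: abs_mult mult.commute)
    moreover from this have "\<bar>y (Suc (Suc k)) * y (Suc k)\<bar> > \<bar>y k\<bar>" using k by linarith
    ultimately show ?case using k sg[of "y k"] rec[of k] by auto
  next
    case (step n)
    then show ?case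
      using escape_step[of "y (Suc n)" "y (Suc (Suc n))" "y (Suc (Suc (Suc n)))" "y (Suc (Suc (Suc (Suc n))))"]
        rec[of "Suc n"] sg[of "y (Suc n)" "y (Suc (Suc (Suc n)))" "y (Suc (Suc n))"]
      by auto
  qed
  then show "\<bar>y (Suc n)\<bar> > 2" "sgn (y (Suc (Suc (Suc n)))) = sgn (y (Suc (Suc n))) * sgn (y (Suc n))"
    by auto
qed

text \<open>Intermediate values between \<open>l + 3\<close>, where all traces are positive, and -3,
  where the signs from index 1 on repeat as minus, minus, plus. At both points the values at indices
  1 and 2 exceed 2 in modulus, so \<open>escape\<close> applies from index 0.\<close>

lemma fib_trace_root:
  fixes l :: real
  assumes "l > 0"
  shows "\<exists>E. fib_trace l E (3 * i + 1) = 0"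
proof -
  define y where "y = fib_trace l (l + 3)"
  define w where "w = fib_trace l (- 3)"
  have "sgn (y (Suc n)) = 1 \<and> sgn (y (Suc (Suc n))) = 1" for n
  proof (induction n)
    case 0
    then show ?case using assms by (simp add: y_def)
  next
    case (Suc n)
    then show ?case using escape(2)[of y 0 n] assms by (simp add: y_def)
  qed
  then have y: "y (3 * i + 1) > 0" by (simp add: sgn_1_pos)
  have "sgn (w (Suc (3 * n))) = -1 \<and> sgn (w (Suc (Suc (3 * n)))) = -1" for n
  proof (induction n)
    case 0
    then show ?case using assms by (simp add: w_def)
  next
    case (Suc n)
    have *: "sgn (w (Suc (Suc (Suc m)))) = sgn (w (Suc (Suc m))) * sgn (w (Suc m))" for m
      using assms by (intro escape(2)[of w 0]) (simp_all add: w_def)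
    have e: "3 * Suc n = Suc (Suc (Suc (3 * n)))" by simp
    from Suc *[of "3 * n"] *[of "Suc (3 * n)"] *[of "Suc (Suc (3 * n))"]
    show ?case unfolding e by simp
  qed
  then have w: "w (3 * i + 1) < 0" by (simp add: sgn_1_neg)
  show ?thesis
    using IVT'[of "\<lambda>E. fib_trace l E (3 * i + 1)" "-3" 0 "l + 3"] y w assms continuous_on_fib_trace
    by (force simp: y_def w_def)
qed

text \<open>A small value at \<open>J\<close> forbids an escape before \<open>J\<close>, so a value
  beyond 2 has both neighbours within 2. The invariant then becomes a quadratic inequality for that
  value.\<close>

lemma fib_trace_bounded:
  fixes l E :: real
  assumes "l > 0" and J: "\<bar>fib_trace l E J\<bar> \<le> 2" and "n < J"
  shows "\<bar>fib_trace l E n\<bar> \<le> l + 6"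
proof -
  define y where "y = fib_trace l E"
  have pair: "\<bar>y k\<bar> \<le> 2 \<or> \<bar>y (Suc k)\<bar> \<le> 2" if "k < J" for k
    using that
  proof (induction k)
    case (Suc k)
    show ?case
    proof (rule ccontr)
      assume "\<not> ?thesis"
      then have "\<bar>y J\<bar> > 2"
        using Suc escape(1)[of y k "J - 1"] by (simp add: y_def)
      then show False using J by (simp add: y_def)
    qed
  qed (simp add: y_def)
  have "\<bar>y n\<bar> \<le> l + 6"
  proof (cases "\<bar>y n\<bar> \<le> 2")
    case False
    then obtain m where m: "n = Suc m" by (cases n) (auto simp: y_def)
    have "\<bar>y m\<bar> \<le> 2" "\<bar>y (Suc n)\<bar> \<le> 2"
      using False pair[of m] pair[of n] \<open>n < J\<close> m by auto
    then have "\<bar>y (Suc n)\<bar> * \<bar>y m\<bar> \<le> 2 * 2" by (intro mult_mono) auto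
    then have "\<bar>y n\<bar> * (\<bar>y (Suc n)\<bar> * \<bar>y m\<bar>) \<le> \<bar>y n\<bar> * 4" by (intro mult_left_mono) auto
    then have "y (Suc n) * y n * y m \<le> 4 * \<bar>y n\<bar>"
      using abs_ge_self[of "y (Suc n) * y n * y m"] by (simp add: abs_mult ac_simps)
    moreover have "(y (Suc n))\<^sup>2 + (y n)\<^sup>2 + (y m)\<^sup>2 - y (Suc n) * y n * y m = 4 + l\<^sup>2"
      using fib_trace_invariant[of l E m] by (simp add: y_def m)
    ultimately have "(y n)\<^sup>2 - 4 * \<bar>y n\<bar> \<le> 4 + l\<^sup>2"
      using zero_le_power2[of "y (Suc n)"] zero_le_power2[of "y m"] by linarith
    then have *: "\<bar>y n\<bar> * (\<bar>y n\<bar> - 4) \<le> 4 + l\<^sup>2"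
      by (simp add: right_diff_distrib power2_eq_square mult.commute)
    show ?thesis
    proof (rule ccontr)
      assume "\<not> ?thesis"
      \<comment> \<open>From \<open>l + 6\<close> on the quadratic is too large:
        \<open>(l + 6) * (l + 2) > 4 + l\<^sup>2\<close>.\<close>
      then have "(l + 6) * (l + 2) \<le> \<bar>y n\<bar> * (\<bar>y n\<bar> - 4)"
        using assms by (intro mult_mono) auto
      with * assms show False by (simp add: algebra_simps power2_eq_square)
    qed
  qed (use assms in auto)
  then show ?thesis by (simp add: y_def)
qed

text \<open>The error grows by at most \<open>Q\<close> per step: the two terms linear in the error
  contribute \<open>2 * \<kappa>\<close>, the quadratic term and the subtracted earlier error 1
  each.\<close>

lemma fib_trace_perturb:
  fixes l E \<kappa> \<epsilon> :: real
  defines "Q \<equiv> 2 * \<kappa> + 2"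
  assumes y: "\<And>n. n \<le> N \<Longrightarrow> \<bar>fib_trace l E n\<bar> \<le> \<kappa>" and "\<epsilon> \<ge> 0" "\<epsilon> * Q ^ N \<le> 1" "n \<le> N"
  shows "cmod (fib_trace (of_real l) (Complex E \<epsilon>) n - of_real (fib_trace l E n)) \<le> \<epsilon> * Q ^ n"
proof -
  have \<kappa>: "\<kappa> \<ge> 2" using y[of 0] by simp
  then have Q: "Q \<ge> 1" by (simp add: Q_def)
  define d where "d = (\<lambda>n. fib_trace (of_real l) (Complex E \<epsilon>) n - of_real (fib_trace l E n))"
  have E: "Complex E \<epsilon> - of_real E = \<i> * of_real \<epsilon>"
    by (simp add: complex_eq_iff)
  have "cmod (d n) \<le> \<epsilon> * Q ^ n"
    using \<open>n \<le> N\<close>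
  proof (induction n rule: less_induct)
    case (less n)
    consider "n = 0" | "n = Suc 0" | "n = Suc (Suc 0)" | m where "n = Suc (Suc (Suc m))"
      by (metis not0_implies_Suc)
    then show ?case
    proof cases
      case 1
      then show ?thesis using \<open>\<epsilon> \<ge> 0\<close> by (simp add: d_def)
    next
      case 2
      then show ?thesis using \<open>\<epsilon> \<ge> 0\<close> Q E by (simp add: d_def norm_mult mult_left_le mult_le_cancel_left1)
    next
      case 3
      have "d n = \<i> * of_real \<epsilon>" using E by (simp add: d_def 3 algebra_simps)
      moreover have "\<epsilon> * 1 \<le> \<epsilon> * Q ^ n" using Q \<open>\<epsilon> \<ge> 0\<close> by (intro mult_left_mono one_le_power)
      ultimately show ?thesis using \<open>\<epsilon> \<ge> 0\<close> by (simp add: norm_mult)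
    next
      case (4 m)
      let ?y1 = "complex_of_real (fib_trace l E (Suc m))"
      let ?y2 = "complex_of_real (fib_trace l E (Suc (Suc m)))"
      let ?d1 = "d (Suc m)" and ?d2 = "d (Suc (Suc m))"
      have b: "cmod (d k) \<le> \<epsilon> * Q ^ k" if "k \<in> {m, Suc m, Suc (Suc m)}" for k
        using that less.IH[of k] less.prems 4 by auto
      have mono: "\<epsilon> * Q ^ a \<le> \<epsilon> * Q ^ b" if "a \<le> b" for a b
        using that Q \<open>\<epsilon> \<ge> 0\<close> by (intro mult_left_mono power_increasing)
      have "d n = ?y2 * ?d1 + ?d2 * ?y1 + ?d2 * ?d1 - d m"
        by (simp add: d_def 4 algebra_simps)
      then have "cmod (d n) \<le> cmod ?y2 * cmod ?d1 + cmod ?d2 * cmod ?y1 + cmod ?d2 * cmod ?d1 + cmod (d m)"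
        by (smt (verit) norm_mult norm_triangle_ineq norm_triangle_ineq4)
      also have "cmod ?y2 * cmod ?d1 \<le> \<kappa> * (\<epsilon> * Q ^ Suc (Suc m))"
        using y[of "Suc (Suc m)"] b[of "Suc m"] mono[of "Suc m" "Suc (Suc m)"] less.prems 4
        by (intro mult_mono) auto
      also have "cmod ?d2 * cmod ?y1 \<le> (\<epsilon> * Q ^ Suc (Suc m)) * \<kappa>"
        using y[of "Suc m"] b[of "Suc (Suc m)"] \<open>\<epsilon> \<ge> 0\<close> Q less.prems 4
        by (intro mult_mono) auto
      \<comment> \<open>By \<open>\<epsilon> * Q ^ N \<le> 1\<close> one of the two error factors is
        at most 1.\<close>
      also have "cmod ?d2 * cmod ?d1 \<le> (\<epsilon> * Q ^ Suc (Suc m)) * 1"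
        using b[of "Suc (Suc m)"] b[of "Suc m"] mono[of "Suc m" N] assms(4) \<open>\<epsilon> \<ge> 0\<close> Q less.prems 4
        by (intro mult_mono) auto
      also have "cmod (d m) \<le> \<epsilon> * Q ^ Suc (Suc m)"
        using b[of m] mono[of m "Suc (Suc m)"] by simp
      finally have "cmod (d n) \<le> (\<epsilon> * Q ^ Suc (Suc m)) * Q"
        by (simp add: Q_def algebra_simps)
      then show ?thesis by (simp add: 4 ac_simps)
    qed
  qed
  then show ?thesis by (simp add: d_def)
qed

text \<open>A root of a trace beyond index \<open>N\<close> bounds the real traces up to
  \<open>N\<close> by \<open>l + 6\<close>. An imaginary part inverse to the error growth, with
  \<open>Q = 2 * (l + 6) + 2\<close>, costs at most 1 more.\<close>

lemma bounded_fib_trace_off_axis: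
  fixes l :: real
  assumes "l > 0"
  shows "\<exists>z. Im z = 1 / (2 * l + 14) ^ N \<and>
    (\<forall>n\<le>N. cmod (fib_trace (of_real l) z n) \<le> l + 7)"
proof -
  obtain E where "fib_trace l E (3 * N + 1) = 0"
    using fib_trace_root[OF assms] by blast
  then have y: "\<bar>fib_trace l E n\<bar> \<le> l + 6" if "n \<le> N" for n
    using fib_trace_bounded[of l E "3 * N + 1" n] assms that by simp
  define \<epsilon> where "\<epsilon> = 1 / (2 * (l + 6) + 2) ^ N"
  have "cmod (fib_trace (of_real l) (Complex E \<epsilon>) n) \<le> l + 7" if "n \<le> N" for n
  proof -
    have "cmod (fib_trace (of_real l) (Complex E \<epsilon>) n - of_real (fib_trace l E n))
      \<le> \<epsilon> * (2 * (l + 6) + 2) ^ n"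
      using assms y that by (intro fib_trace_perturb[where N = N]) (auto simp: \<epsilon>_def)
    also have "\<dots> \<le> \<epsilon> * (2 * (l + 6) + 2) ^ N"
      using assms that by (intro mult_left_mono power_increasing) (auto simp: \<epsilon>_def)
    also have "\<dots> = 1" using assms by (simp add: \<epsilon>_def)
    finally have "cmod (fib_trace (of_real l) (Complex E \<epsilon>) n - of_real (fib_trace l E n)) \<le> 1" .
    moreover have "cmod (of_real (fib_trace l E n)) \<le> l + 6" using y[OF that] by simp
    ultimately show ?thesis
      using norm_triangle_sub[of "fib_trace (of_real l) (Complex E \<epsilon>) n" "of_real (fib_trace l E n)"]
      by linarith
  qed
  then show ?thesis
    by (intro exI[of _ "Complex E \<epsilon>"]) (simp add: \<epsilon>_def algebra_simps)
qed

section \<open>Transfer matrices along the rotation\<close>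

type_synonym mat2 = "complex^2^2"

definition cscale :: "complex \<Rightarrow> mat2 \<Rightarrow> mat2" where
  "cscale c M = (\<chi> i j. c * M $ i $ j)"

definition entries_le :: "mat2 \<Rightarrow> real \<Rightarrow> bool" where
  "entries_le M b \<longleftrightarrow> (\<forall>i j. cmod (M $ i $ j) \<le> b)"

lemma entries_le_mono: "entries_le M b \<Longrightarrow> b \<le> c \<Longrightarrow> entries_le M c"
  unfolding entries_le_def using order_trans by blast

lemma entries_le_mult:
  assumes "entries_le M b" "entries_le M' c" "0 \<le> b"
  shows "entries_le (M ** M') (2 * b * c)"
proof -
  have "cmod (M $ i $ k * M' $ k $ j) \<le> b * c" for i j k
    using assms unfolding entries_le_def norm_mult by (intro mult_mono) auto
  then have "cmod (\<Sum>k\<in>UNIV. M $ i $ k * M' $ k $ j) \<le> real CARD(2) * (b * c)" for i j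
    by (intro order_trans[OF norm_sum] order_trans[OF sum_bounded_above]) auto
  then show ?thesis by (simp add: entries_le_def matrix_matrix_mult_def mult.assoc)
qed

lemma entries_le_cscale_diff:
  assumes "entries_le M b" "entries_le M' b'" "cmod c \<le> k" "0 \<le> k"
  shows "entries_le (cscale c M - M') (k * b + b')"
proof -
  have "cmod (c * M $ i $ j - M' $ i $ j) \<le> k * b + b'" for i j
  proof -
    have "cmod (c * M $ i $ j) \<le> k * b"
      using assms unfolding entries_le_def norm_mult by (intro mult_mono) auto
    moreover have "cmod (M' $ i $ j) \<le> b'" using assms by (simp add: entries_le_def)
    ultimately show ?thesis using norm_triangle_ineq4[of "c * M $ i $ j" "M' $ i $ j"] by linarith
  qed
  then show ?thesis by (simp add: entries_le_def cscale_def)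
qed

text \<open>For determinant 1 a square is the trace times the matrix minus the identity. Products
  with a repeated factor are thus controlled by traces, without multiplying norms.\<close>

lemma cayley_hamilton_right:
  fixes A B :: mat2
  assumes "det B = 1"
  shows "A ** B ** B = cscale (trace B) (A ** B) - A"
proof -
  have B: "B $ 1 $ 1 * B $ 2 $ 2 = 1 + B $ 1 $ 2 * B $ 2 $ 1"
    using assms by (simp add: det_2 algebra_simps)
  have "B ** B = cscale (trace B) B - mat 1"
    using B by (simp add: vec_eq_iff forall_2 matrix_matrix_mult_def sum_2 cscale_def trace_def mat_def
        algebra_simps)
  then have "A ** B ** B = A ** (cscale (trace B) B - mat 1)"
    by (simp add: matrix_mul_assoc[symmetric])
  also have "\<dots> = cscale (trace B) (A ** B) - A"
    by (simp add: vec_eq_iff forall_2 matrix_matrix_mult_def sum_2 cscale_def mat_def algebra_simps)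
  finally show ?thesis .
qed

lemma cayley_hamilton_left:
  fixes A B :: mat2
  assumes "det A = 1"
  shows "A ** (A ** B) = cscale (trace A) (A ** B) - B"
proof -
  have "A $ 1 $ 1 * A $ 2 $ 2 = 1 + A $ 1 $ 2 * A $ 2 $ 1"
    using assms by (simp add: det_2 algebra_simps)
  then have "A ** A = cscale (trace A) A - mat 1"
    by (simp add: vec_eq_iff forall_2 matrix_matrix_mult_def sum_2 cscale_def trace_def mat_def
        algebra_simps)
  then have "A ** (A ** B) = (cscale (trace A) A - mat 1) ** B"
    by (simp add: matrix_mul_assoc)
  also have "\<dots> = cscale (trace A) (A ** B) - B"
    by (simp add: vec_eq_iff forall_2 matrix_matrix_mult_def sum_2 cscale_def mat_def algebra_simps)
  finally show ?thesis .
qed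

lemma trace_cscale_diff: "trace (cscale c M - M') = c * trace M - trace M'"
  by (simp add: trace_def cscale_def sum_2 algebra_simps)

text \<open>The inverse of the usual transfer matrix, so that words multiply in reading order.\<close>
definition tmat :: "complex \<Rightarrow> real \<Rightarrow> mat2" where
  "tmat z v = vector [vector [0, 1], vector [- 1, z - of_real v]]"

lemma det_tmat: "det (tmat z v) = 1"
  by (simp add: tmat_def det_2)

section \<open>Renormalized transfer matrices and their traces\<close>

text \<open>Matrices of the words from iterating A -> AB, B -> ABB. One level makes two Fibonacci
  steps: the lengths are 1, 1, then 2, 3, then 5, 8.\<close>

fun fibA fibB :: "complex \<Rightarrow> real \<Rightarrow> nat \<Rightarrow> mat2" where
  "fibA z l 0 = tmat z 0"
| "fibB z l 0 = tmat z l"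
| "fibA z l (Suc m) = fibA z l m ** fibB z l m"
| "fibB z l (Suc m) = fibA z l m ** fibB z l m ** fibB z l m"

lemma det_fib: "det (fibA z l m) = 1 \<and> det (fibB z l m) = 1"
  by (induction m) (simp_all add: det_tmat det_mul)

lemma fibB_Suc:
  "fibB z l (Suc m) = cscale (trace (fibB z l m)) (fibA z l (Suc m)) - fibA z l m"
  using det_fib by (simp add: cayley_hamilton_right)

text \<open>Since ABB = (AB)B, the product begins with the square of AB.\<close>

lemma fibAB_Suc:
  "fibA z l (Suc m) ** fibB z l (Suc m) =
     cscale (trace (fibA z l (Suc m))) (fibB z l (Suc m)) - fibB z l m"
proof -
  have "fibB z l (Suc m) = fibA z l (Suc m) ** fibB z l m" by simp
  then show ?thesis
    using cayley_hamilton_left[of "fibA z l (Suc m)" "fibB z l m"] det_fib[of z l "Suc m"] by simp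
qed

text \<open>Traces in \<open>fibB_Suc\<close> and \<open>fibAB_Suc\<close> give two steps of the
  trace map per level; the third conjunct supplies the next trace of \<open>fibA\<close>.\<close>

lemma trace_fib:
  "trace (fibA z l m) = fib_trace (of_real l) z (2 * m + 1) \<and>
   trace (fibB z l m) = fib_trace (of_real l) z (2 * m + 2) \<and>
   trace (fibA z l m ** fibB z l m) = fib_trace (of_real l) z (2 * m + 3)"
proof (induction m)
  case 0
  show ?case
    by (simp add: tmat_def trace_def sum_2 matrix_matrix_mult_def numeral_2_eq_2 numeral_3_eq_3 algebra_simps)
next
  case (Suc m)
  have e: "2 * Suc m + 1 = Suc (Suc (Suc (2 * m)))" "2 * Suc m + 2 = Suc (Suc (Suc (Suc (2 * m))))"
     "2 * Suc m + 3 = Suc (Suc (Suc (Suc (Suc (2 * m)))))" by simp_all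
  have i: "trace (fibA z l m) = fib_trace (of_real l) z (Suc (2 * m))"
    "trace (fibB z l m) = fib_trace (of_real l) z (Suc (Suc (2 * m)))"
    and A: "trace (fibA z l (Suc m)) = fib_trace (of_real l) z (Suc (Suc (Suc (2 * m))))"
    using Suc by (simp_all add: numeral_3_eq_3)
  have B: "trace (fibB z l (Suc m)) = fib_trace (of_real l) z (Suc (Suc (Suc (Suc (2 * m)))))"
    unfolding fibB_Suc trace_cscale_diff i A by (simp add: mult.commute)
  have "trace (fibA z l (Suc m) ** fibB z l (Suc m)) =
      fib_trace (of_real l) z (Suc (Suc (Suc (Suc (Suc (2 * m))))))"
    unfolding fibAB_Suc trace_cscale_diff i A B by (simp add: mult.commute)
  with A B show ?case unfolding e by blast
qed

text \<open>Each of the two Cayley-Hamilton steps per level costs at most a factor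
  \<open>\<kappa> + 1\<close>, so the bound is only exponential in the level.\<close>

lemma entries_fib_le:
  assumes \<kappa>: "\<kappa> \<ge> 2" and y: "\<And>n. n \<le> 2 * m + 3 \<Longrightarrow> cmod (fib_trace (of_real l) z n) \<le> \<kappa>"
  shows "entries_le (fibA z l m) ((\<kappa> + 1) ^ (2 * m + 2)) \<and> entries_le (fibB z l m) ((\<kappa> + 1) ^ (2 * m + 2))
    \<and> entries_le (fibA z l m ** fibB z l m) ((\<kappa> + 1) ^ (2 * m + 2))"
  using y
proof (induction m)
  case 0
  have z: "cmod z \<le> \<kappa>" "cmod (z - of_real l) \<le> \<kappa>"
    using 0[of 1] 0[of 2] by (simp_all add: numeral_2_eq_2)
  have "\<kappa> * 1 \<le> \<kappa> * \<kappa>" using \<kappa> by (intro mult_left_mono) auto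
  then have k: "1 \<le> \<kappa>\<^sup>2" "\<kappa> \<le> \<kappa>\<^sup>2"
    unfolding power2_eq_square using \<kappa> by linarith+
  have e: "(\<kappa> + 1) ^ (2 * 0 + 2) = \<kappa>\<^sup>2 + 2 * \<kappa> + 1" by (simp add: power2_eq_square algebra_simps)
  have "cmod (z * (z - of_real l)) \<le> \<kappa> * \<kappa>"
    unfolding norm_mult using z \<kappa> by (intro mult_mono) auto
  then have "cmod (z * (z - of_real l) - 1) \<le> \<kappa>\<^sup>2 + 1"
    using norm_triangle_ineq4[of "z * (z - of_real l)" 1] by (simp add: power2_eq_square)
  then show ?case
    unfolding e using z \<kappa> k
    by (simp add: entries_le_def forall_2 tmat_def matrix_matrix_mult_def sum_2)
next
  case (Suc m)
  let ?n = "(\<kappa> + 1) ^ (2 * m + 2)"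
  have IH: "entries_le (fibA z l m) ?n" "entries_le (fibB z l m) ?n" "entries_le (fibA z l (Suc m)) ?n"
    using Suc by auto
  have n: "0 \<le> ?n" using \<kappa> by simp
  have t: "cmod (trace (fibB z l m)) \<le> \<kappa>" "cmod (trace (fibA z l (Suc m))) \<le> \<kappa>"
  proof -
    have "cmod (fib_trace (of_real l) z (2 * m + 2)) \<le> \<kappa>"
      "cmod (fib_trace (of_real l) z (2 * Suc m + 1)) \<le> \<kappa>" by (rule Suc.prems, simp)+
    then show "cmod (trace (fibB z l m)) \<le> \<kappa>" "cmod (trace (fibA z l (Suc m))) \<le> \<kappa>"
      by (simp_all only: trace_fib)
  qed
  have B: "entries_le (fibB z l (Suc m)) (\<kappa> * ?n + ?n)"
    unfolding fibB_Suc using IH t \<kappa> by (intro entries_le_cscale_diff) auto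
  have C: "entries_le (fibA z l (Suc m) ** fibB z l (Suc m)) (\<kappa> * (\<kappa> * ?n + ?n) + ?n)"
    unfolding fibAB_Suc using IH B t \<kappa> by (intro entries_le_cscale_diff) auto
  have e: "(\<kappa> + 1) ^ (2 * Suc m + 2) = (\<kappa> * (\<kappa> * ?n + ?n) + ?n) + \<kappa> * ?n"
    by (simp add: power2_eq_square algebra_simps)
  have k: "0 \<le> \<kappa> * ?n" "0 \<le> \<kappa> * (\<kappa> * ?n)" using \<kappa> n by simp_all
  show ?case unfolding e
    using IH(3) B C k n by (auto elim!: entries_le_mono simp: algebra_simps)
qed

section \<open>Transfer products and solutions of the eigenvalue equation\<close>

fun tprod :: "complex \<Rightarrow> (nat \<Rightarrow> real) \<Rightarrow> nat \<Rightarrow> nat \<Rightarrow> mat2" where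
  "tprod z V r 0 = mat 1"
| "tprod z V r (Suc L) = tmat z (V r) ** tprod z V (Suc r) L"

lemma tprod_add: "tprod z V r (L + L') = tprod z V r L ** tprod z V (r + L) L'"
  by (induction L arbitrary: r) (simp_all add: matrix_mul_assoc[symmetric])

lemma tprod_solution:
  assumes "\<And>k. 1 \<le> k \<Longrightarrow> u (k + 1) + u (k - 1) + of_real (V k) * u k = z * u k"
  shows "vector [u (Suc r), u r] = tprod z V (Suc r) L *v (vector [u (Suc (r + L)), u (r + L)] :: complex^2)"
proof (induction L arbitrary: r)
  case 0
  show ?case by simp
next
  case (Suc L)
  have "vector [u (Suc r), u r] = tmat z (V (Suc r)) *v (vector [u (Suc (Suc r)), u (Suc r)] :: complex^2)"
    using assms[of "Suc r"]
    by (simp add: vec_eq_iff forall_2 matrix_vector_mult_def sum_2 tmat_def algebra_simps)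
  also have "vector [u (Suc (Suc r)), u (Suc r)] =
      tprod z V (Suc (Suc r)) L *v (vector [u (Suc (Suc r + L)), u (Suc r + L)] :: complex^2)"
    by (rule Suc)
  finally show ?case by (simp add: matrix_vector_mul_assoc)
qed

text \<open>Limits the decay: with a moderate transfer product, a solution that is nonzero at site 0
  cannot be tiny at both \<open>P\<close> and \<open>P + 1\<close>.\<close>

lemma solution_le:
  assumes "\<And>k. 1 \<le> k \<Longrightarrow> u (k + 1) + u (k - 1) + of_real (V k) * u k = z * u k"
    and "entries_le (tprod z V 1 P) b"
  shows "cmod (u 0) \<le> b * (cmod (u (P + 1)) + cmod (u P))"
proof -
  let ?T = "tprod z V 1 P"
  have "vector [u (Suc 0), u 0] = ?T *v (vector [u (Suc P), u P] :: complex^2)"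
    using tprod_solution[of u V z 0 P] assms(1) by simp
  then have "u 0 = ?T $ 2 $ 1 * u (Suc P) + ?T $ 2 $ 2 * u P"
    by (simp add: vec_eq_iff forall_2 matrix_vector_mult_def sum_2)
  then have "cmod (u 0) \<le> cmod (?T $ 2 $ 1) * cmod (u (Suc P)) + cmod (?T $ 2 $ 2) * cmod (u P)"
    by (metis norm_mult norm_triangle_ineq)
  also have "\<dots> \<le> b * cmod (u (Suc P)) + b * cmod (u P)"
    using assms(2) by (intro add_mono mult_right_mono) (auto simp: entries_le_def)
  finally show ?thesis by (simp add: algebra_simps)
qed


section \<open>The golden rotation and its Rauzy induction\<close>

definition gold :: real where "gold = 1 / phi"

lemma gold: "gold\<^sup>2 = 1 - gold" "1 / 2 < gold" "gold < 1"
proof -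
  have s: "2 < sqrt 5" "sqrt 5 < 3" by (rule real_less_rsqrt real_less_lsqrt; simp)+
  have p: "phi\<^sup>2 = phi + 1"
    by (simp add: phi_def power2_eq_square field_simps)
  have "phi > 0" using s by (simp add: phi_def)
  then have "gold = phi - 1" using p by (simp add: gold_def field_simps power2_eq_square)
  with s show "1 / 2 < gold" "gold < 1"
    by (simp_all add: phi_def)
  show "gold\<^sup>2 = 1 - gold"
    unfolding \<open>gold = phi - 1\<close> using p by (simp add: power2_eq_square algebra_simps)
qed

definition rot :: "real \<Rightarrow> nat \<Rightarrow> real" where "rot om r = frac (real r / phi + om)"

lemma rot_range: "0 \<le> rot om r" "rot om r < 1"
  by (simp_all add: rot_def frac_lt_1)

lemma fibV_rot: "fibV lam om r = (if rot om r < gold\<^sup>2 then 0 else lam)"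
  using rot_range[of om r] gold(1) by (simp add: fibV_def Let_def gold_def rot_def)

text \<open>Because \<open>gold\<^sup>2 = 1 - gold\<close>, rotation by \<open>gold\<close> is an
  exchange of two intervals, and these are also the intervals that code the potential.\<close>

lemma rot_Suc: "rot om (Suc r) = (if rot om r < gold\<^sup>2 then rot om r + gold else rot om r - gold\<^sup>2)"
proof -
  have f: "frac (gold + x) = (if frac x + gold < 1 then frac x + gold else frac x + gold - 1)" for x
    using gold frac_add[of x gold] frac_eq[of gold] by (simp add: add.commute)
  have e: "real (Suc r) / phi + om = gold + (real r / phi + om)"
    by (simp add: gold_def add_divide_distrib)
  show ?thesis unfolding rot_def e f using gold(1) by auto
qed

text \<open>Lengths of the words behind \<open>fibA\<close> and \<open>fibB\<close>.\<close>

fun lenA lenB :: "nat \<Rightarrow> nat" where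
  "lenA 0 = 1"
| "lenB 0 = 1"
| "lenA (Suc m) = lenA m + lenB m"
| "lenB (Suc m) = lenA m + lenB m + lenB m"

lemma len_ge: "2 ^ m \<le> lenA m" "2 ^ m \<le> lenB m"
proof -
  have "2 ^ m \<le> lenA m \<and> 2 ^ m \<le> lenB m" by (induction m) auto
  then show "2 ^ m \<le> lenA m" "2 ^ m \<le> lenB m" by auto
qed

lemma gold_power_Suc:
  "gold ^ (2 * Suc m + 2) = 2 * gold ^ (2 * m + 2) - gold ^ (2 * m + 1)"
  "gold ^ (2 * Suc m + 1) = gold ^ (2 * m + 1) - gold ^ (2 * m + 2)"
  "gold ^ (2 * m + 2) < gold ^ (2 * m + 1)"
proof -
  have g: "gold * gold = 1 - gold" using gold(1) by (simp add: power2_eq_square)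
  have e: "gold ^ (2 * m + 2) = gold ^ (2 * m + 1) * gold" by simp
  have "gold ^ (2 * Suc m + 1) = gold ^ (2 * m + 1) * (gold * gold)" by simp
  also have "\<dots> = gold ^ (2 * m + 1) - gold ^ (2 * m + 2)" unfolding g e by (simp only: right_diff_distrib mult_1_right)
  finally show 1: "gold ^ (2 * Suc m + 1) = gold ^ (2 * m + 1) - gold ^ (2 * m + 2)" .
  have "gold ^ (2 * m + 2) * gold = gold ^ (2 * Suc m + 1)" by (simp add: ac_simps)
  note 2 = trans[OF this 1]
  have "gold ^ (2 * Suc m + 2) = gold ^ (2 * m + 2) * (gold * gold)" by simp
  also have "\<dots> = gold ^ (2 * m + 2) - gold ^ (2 * m + 2) * gold" unfolding g by (simp only: right_diff_distrib mult_1_right)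
  finally show "gold ^ (2 * Suc m + 2) = 2 * gold ^ (2 * m + 2) - gold ^ (2 * m + 1)" unfolding 2 by simp
  show "gold ^ (2 * m + 2) < gold ^ (2 * m + 1)"
    using gold by (intro power_strict_decreasing) auto
qed

text \<open>Inducing the exchange of two intervals of lengths \<open>a < b\<close> on its first \<open>a\<close> units gives the
  exchange of \<open>2 a - b\<close> and \<open>b - a\<close>, with return words \<open>AB\<close> and \<open>ABB\<close>.\<close>
lemma renormalization:
  fixes lam om z m
  defines "T \<equiv> tprod z (fibV lam om)"
  defines "a \<equiv> gold ^ (2 * m + 2)" and "b \<equiv> gold ^ (2 * m + 1)"
  shows "(rot om r < a \<longrightarrow>
            T r (lenA m) = fibA z lam m \<and> rot om (r + lenA m) = rot om r + b) \<and>
         (a \<le> rot om r \<and> rot om r < a + b \<longrightarrow>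
            T r (lenB m) = fibB z lam m \<and> rot om (r + lenB m) = rot om r - a)"
  unfolding a_def b_def
proof (induction m arbitrary: r)
  case 0
  show ?case
    using rot_Suc[of om r] by (auto simp: T_def fibV_rot power2_eq_square)
next
  case (Suc m)
  define a where "a = gold ^ (2 * m + 2)"
  define b where "b = gold ^ (2 * m + 1)"
  have p: "gold ^ (2 * Suc m + 2) = 2 * a - b" "gold ^ (2 * Suc m + 1) = b - a" "a < b"
    unfolding a_def b_def by (fact gold_power_Suc)+
  have "0 < gold ^ (2 * Suc m + 2)" using gold by (intro zero_less_power) simp
  then have a': "0 < 2 * a - b" by (simp only: p)
  note IH = Suc.IH[folded a_def b_def]
  have AB: "T r (lenA m) = fibA z lam m" "rot om (r + lenA m) = rot om r + b"
    "T (r + lenA m) (lenB m) = fibB z lam m" "rot om (r + lenA m + lenB m) = rot om r + b - a"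
    if "rot om r < a"
  proof -
    show A: "T r (lenA m) = fibA z lam m" "rot om (r + lenA m) = rot om r + b"
      using IH[of r] that by blast+
    have "a \<le> rot om (r + lenA m) \<and> rot om (r + lenA m) < a + b"
      unfolding A using that p(3) rot_range(1)[of om r] by linarith
    then show "T (r + lenA m) (lenB m) = fibB z lam m" "rot om (r + lenA m + lenB m) = rot om r + b - a"
      using IH[of "r + lenA m"] A by auto
  qed
  show ?case unfolding p(1,2)
  proof (intro conjI impI)
    assume "rot om r < 2 * a - b"
    then have "rot om r < a" using p by linarith
    from AB[OF this] show "T r (lenA (Suc m)) = fibA z lam (Suc m)"
      by (simp add: T_def tprod_add)
  next
    assume "rot om r < 2 * a - b"
    then have "rot om r < a" using p by linarith
    from AB[OF this] show "rot om (r + lenA (Suc m)) = rot om r + (b - a)"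
      by (simp add: add.assoc)
  next
    assume *: "2 * a - b \<le> rot om r \<and> rot om r < 2 * a - b + (b - a)"
    then have "rot om r < a" by linarith
    note AB = AB[OF this]
    \<comment> \<open>After AB such a point is still at least \<open>a\<close>, so one more B
      follows.\<close>
    have "a \<le> rot om (r + lenA m + lenB m) \<and> rot om (r + lenA m + lenB m) < a + b"
      using * AB(4) a' p(3) by linarith
    then have B: "T (r + lenA m + lenB m) (lenB m) = fibB z lam m"
      "rot om (r + lenA m + lenB m + lenB m) = rot om r + b - a - a"
      using IH[of "r + lenA m + lenB m"] AB(4) by auto
    show "T r (lenB (Suc m)) = fibB z lam (Suc m)"
      using AB B by (simp add: T_def tprod_add add.assoc[symmetric])
    show "rot om (r + lenB (Suc m)) = rot om r - (2 * a - b)"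
      using B by (simp add: add.assoc)
  qed
qed

text \<open>Reaches the level-\<open>m\<close> interval from any phase. At each level a block B
  moves the point left by \<open>a\<close>, and as \<open>b < 2 a\<close> at most two blocks lead
  into the next interval. Each block costs a factor \<open>2 * n\<close>.\<close>

lemma climb:
  assumes "1 \<le> n" "\<And>j. j < m \<Longrightarrow> entries_le (fibB z lam j) n"
  shows "\<exists>s. rot om (1 + s) < gold ^ (2 * m + 2) + gold ^ (2 * m + 1) \<and>
    entries_le (tprod z (fibV lam om) 1 s) ((2 * n) ^ (2 * m))"
  using assms(2)
proof (induction m)
  case 0
  have "rot om 1 < gold\<^sup>2 + gold" using rot_range[of om 1] gold by simp
  then show ?case by (intro exI[of _ 0]) (simp add: entries_le_def mat_def power2_eq_square)
next
  case (Suc m)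
  let ?a = "gold ^ (2 * m + 2)" and ?b = "gold ^ (2 * m + 1)" and ?T = "tprod z (fibV lam om)"
  note p = gold_power_Suc[of m]
  have a': "0 < gold ^ (2 * Suc m + 2)" using gold by simp
  \<comment> \<open>The next interval is the first part, of length \<open>a\<close>, of the present
    one.\<close>
  have s': "gold ^ (2 * Suc m + 2) + gold ^ (2 * Suc m + 1) = ?a" unfolding p by simp
  have pow: "(2 * n) ^ (2 * m) \<le> (2 * n) ^ (2 * Suc m)" "(2 * n) ^ (2 * m) * (2 * n) \<le> (2 * n) ^ (2 * Suc m)"
    using assms(1) power_increasing[of "2*m" "2*Suc m" "2*n"] power_increasing[of "2*m+1" "2*Suc m" "2*n"]
    by (auto simp: mult.commute)
  from Suc obtain s where s: "rot om (1 + s) < ?a + ?b" "entries_le (?T 1 s) ((2 * n) ^ (2 * m))"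
    by auto
  have B: "entries_le (fibB z lam m) n" using Suc.prems by simp
  have step: "entries_le (?T 1 (s + lenB m)) (q * (2 * n))"
      "rot om (1 + (s + lenB m)) = rot om (1 + s) - ?a"
    if "entries_le (?T 1 s) q" "?a \<le> rot om (1 + s)" "rot om (1 + s) < ?a + ?b" "0 \<le> q" for s q
    using renormalization[of om "1 + s" m z lam] that entries_le_mult[OF that(1) B]
    by (auto simp: tprod_add ac_simps)
  show ?case unfolding s'
  proof (cases "rot om (1 + s) < ?a")
    case True
    then show "\<exists>s. rot om (1 + s) < ?a \<and> entries_le (?T 1 s) ((2 * n) ^ (2 * Suc m))"
      using s(2) pow(1) entries_le_mono by blast
  next
    case False
    then have 1: "entries_le (?T 1 (s + lenB m)) ((2 * n) ^ (2 * m) * (2 * n))"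
        "rot om (1 + (s + lenB m)) = rot om (1 + s) - ?a"
      using step[OF s(2)] s(1) assms(1) by auto
    show "\<exists>s. rot om (1 + s) < ?a \<and> entries_le (?T 1 s) ((2 * n) ^ (2 * Suc m))"
    proof (cases "rot om (1 + (s + lenB m)) < ?a")
      case True
      then show ?thesis using 1(1) pow(2) entries_le_mono by blast
    next
      case f: False
      have "0 < ?a" using gold by simp
      then have "rot om (1 + (s + lenB m)) < ?a + ?b" using 1(2) s(1) by linarith
      then have e: "entries_le (?T 1 (s + lenB m + lenB m)) ((2 * n) ^ (2 * m) * (2 * n) * (2 * n))"
        and r: "rot om (1 + (s + lenB m + lenB m)) = rot om (1 + (s + lenB m)) - ?a"
        using step[OF 1(1)] f assms(1) by auto
      have "(2 * n) ^ (2 * m) * (2 * n) * (2 * n) = (2 * n) ^ (2 * Suc m)"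
        by (simp add: power2_eq_square power_add)
      then have "entries_le (?T 1 (s + lenB m + lenB m)) ((2 * n) ^ (2 * Suc m))"
        using e by (simp only:)
      \<comment> \<open>From \<open>x < a + b\<close> follows \<open>x - 2 a < b - a < a\<close>, as
        the next length \<open>2 a - b\<close> is positive.\<close>
      moreover have "rot om (1 + (s + lenB m + lenB m)) < ?a"
        using r 1(2) s(1) a' p(1) by linarith
      ultimately show ?thesis by blast
    qed
  qed
qed

text \<open>One more block of level \<open>m\<close>, of length at least \<open>2 ^ m\<close>, makes
  the product long; in all at most \<open>2 * m + 1\<close> blocks occur.\<close>

lemma transfer_subexponential:
  assumes "\<kappa> \<ge> 2" "\<And>n. n \<le> 2 * m + 3 \<Longrightarrow> cmod (fib_trace (of_real lam) z n) \<le> \<kappa>"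
  shows "\<exists>P\<ge>2 ^ m. entries_le (tprod z (fibV lam om) 1 P) ((2 * (\<kappa> + 1) ^ (2 * m + 2)) ^ (2 * m + 1))"
proof -
  define n where "n = (\<kappa> + 1) ^ (2 * m + 2)"
  have n: "1 \<le> n" unfolding n_def using assms(1) by (intro one_le_power) auto
  have e: "entries_le (fibA z lam j) n \<and> entries_le (fibB z lam j) n" if "j \<le> m" for j
  proof -
    have "(\<kappa> + 1) ^ (2 * j + 2) \<le> n"
      unfolding n_def using that assms(1) by (intro power_increasing) auto
    then show ?thesis
      using entries_fib_le[OF assms(1), of j lam z] assms(2) that entries_le_mono by force
  qed
  obtain s where s: "rot om (1 + s) < gold ^ (2 * m + 2) + gold ^ (2 * m + 1)"
      "entries_le (tprod z (fibV lam om) 1 s) ((2 * n) ^ (2 * m))"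
    using climb[OF n, of m z lam om] e by auto
  obtain L where L: "L \<ge> 2 ^ m" "entries_le (tprod z (fibV lam om) (1 + s) L) n"
  proof (cases "rot om (1 + s) < gold ^ (2 * m + 2)")
    case True
    then show thesis
      using that[of "lenA m"] renormalization[of om "1 + s" m z lam] e[of m] len_ge by auto
  next
    case False
    then show thesis
      using that[of "lenB m"] renormalization[of om "1 + s" m z lam] e[of m] len_ge s(1) by auto
  qed
  have "entries_le (tprod z (fibV lam om) 1 (s + L)) (2 * (2 * n) ^ (2 * m) * n)"
    unfolding tprod_add using s L n by (intro entries_le_mult) auto
  moreover have "2 * (2 * n) ^ (2 * m) * n = (2 * n) ^ (2 * m + 1)" by (simp add: ac_simps)
  ultimately have "entries_le (tprod z (fibV lam om) 1 (s + L)) ((2 * n) ^ (2 * m + 1))"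
    by (simp only:)
  moreover have "s + L \<ge> 2 ^ m" using L by simp
  ultimately show ?thesis unfolding n_def[symmetric] by blast
qed

section \<open>Absence of localization\<close>

lemma Hpow_Suc_tridiagonal:
  assumes "1 \<le> l" "1 \<le> m"
  shows "Hpow lam om (Suc k) l m =
    Hpow lam om k l (m + 1) + Hpow lam om k l (m - 1) + fibV lam om m * Hpow lam om k l m"
proof -
  have 0: "Hpow lam om k l 0 = 0"
    using assms(1) by (cases k) (auto simp: Hent_def)
  have "Hpow lam om (Suc k) l m = (\<Sum>p\<in>{1..m+1}. Hpow lam om k l p * Hent lam om p m)"
    by (simp only: Hpow.simps)
  also have "\<dots> = (\<Sum>p\<in>{1..m+1}. ((if p = m + 1 then Hpow lam om k l p else 0)
      + (if p = m - 1 then Hpow lam om k l p else 0))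
      + (if p = m then fibV lam om p * Hpow lam om k l p else 0))"
    using assms by (intro sum.cong) (auto simp: Hent_def)
  also have "\<dots> = Hpow lam om k l (m + 1) + Hpow lam om k l (m - 1) + fibV lam om m * Hpow lam om k l m"
    unfolding sum.distrib using assms 0 by (subst (1 2 3) sum.delta) (auto simp: not_le)
  finally show ?thesis .
qed

lemma Uent_0: "Uent lam om 0 l m = (if l = m then 1 else 0)"
proof -
  have "(\<lambda>k. (- \<i> * of_real 0) ^ k / of_nat (fact k) * of_real (Hpow lam om k l m)) =
    (\<lambda>k. if k = 0 then (if l = m then 1 else 0) else 0)"
    by (rule ext, case_tac k) auto
  then show ?thesis
    unfolding Uent_def using sums_unique[OF sums_single[of 0 "\<lambda>_. if l = m then 1 else 0 :: complex"]]
    by simp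
qed

lemma Uent_l_0: "1 \<le> l \<Longrightarrow> Uent lam om t l 0 = 0"
proof -
  assume "1 \<le> l"
  then have "Hpow lam om k l 0 = 0" for k by (cases k) (auto simp: Hent_def)
  then show ?thesis by (simp add: Uent_def)
qed

text \<open>Differentiating the power series in \<open>t\<close> raises the power of
  \<open>H\<close> by one, and \<open>H\<close> is tridiagonal.\<close>

lemma Uent_has_vector_derivative:
  assumes "1 \<le> l" "1 \<le> m"
  shows "((\<lambda>t. Uent lam om t l m) has_vector_derivative
    - \<i> * (Uent lam om t l (m + 1) + Uent lam om t l (m - 1) + fibV lam om m * Uent lam om t l m))
      (at t within S)"
proof -
  define c where "c = (\<lambda>m k. (- \<i>) ^ k / of_nat (fact k) * complex_of_real (Hpow lam om k l m))"
  have c: "w ^ k / of_nat (fact k) * of_real (Hpow lam om k l m) = c m k * (\<i> * w) ^ k" for w m k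
    by (simp add: c_def flip: power_mult_distrib)
  have "summable (\<lambda>k. c m k * (\<i> * (- \<i> * y)) ^ k)" for y m
    using summable_norm_cancel[OF summable_Uent[of "- \<i> * y" lam om l m]] unfolding c .
  then have s: "summable (\<lambda>k. c m k * y ^ k)" for y m by simp
  have U: "Uent lam om t l m = (\<Sum>k. c m k * of_real t ^ k)" for t m
    unfolding Uent_def c by simp
  have d: "diffs (c m) k = - \<i> * (c (m + 1) k + c (m - 1) k + fibV lam om m * c m k)" for k
  proof -
    have "diffs (c m) k = - \<i> * ((- \<i>) ^ k / of_nat (fact k) * complex_of_real (Hpow lam om (Suc k) l m))"
      by (simp add: diffs_def c_def del: Hpow.simps of_nat_Suc)
    then show ?thesis
      unfolding Hpow_Suc_tridiagonal[OF assms] by (simp add: c_def algebra_simps)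
  qed
  have "(\<Sum>k. diffs (c m) k * of_real t ^ k) =
      (\<Sum>k. - \<i> * (c (m + 1) k * of_real t ^ k + c (m - 1) k * of_real t ^ k + fibV lam om m * (c m k * of_real t ^ k)))"
    unfolding d by (simp add: algebra_simps)
  also have "\<dots> = - \<i> * (Uent lam om t l (m + 1) + Uent lam om t l (m - 1) + fibV lam om m * Uent lam om t l m)"
    unfolding U
    by (intro sums_unique[symmetric] sums_mult sums_add summable_sums s)
  finally show ?thesis
    using has_vector_derivative_real_field[OF termdiffs_strong_converges_everywhere[of "c m", OF s], of t S]
    unfolding U by simp
qed

lemma exp_Uent_has_vector_derivative:
  assumes "1 \<le> l" "1 \<le> m"
  shows "((\<lambda>t. exp (c * of_real t) * Uent lam om t l m) has_vector_derivative
    exp (c * of_real t) * (c * Uent lam om t l m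
      - \<i> * (Uent lam om t l (m + 1) + Uent lam om t l (m - 1) + fibV lam om m * Uent lam om t l m)))
      (at t within S)"
proof -
  have "((\<lambda>x::complex. exp (c * x)) has_field_derivative exp (c * of_real t) * c) (at (of_real t))"
    by (auto intro!: derivative_eq_intros)
  then have "((\<lambda>t. exp (c * of_real t)) has_vector_derivative exp (c * of_real t) * c) (at t within S)"
    by (rule has_vector_derivative_real_field)
  from has_vector_derivative_mult[OF this Uent_has_vector_derivative[OF assms]]
  show ?thesis by (simp add: algebra_simps)
qed

lemma continuous_Uent: "1 \<le> l \<Longrightarrow> isCont (\<lambda>t. Uent lam om t l m) t"
proof (cases "m = 0")
  case False
  assume "1 \<le> l"
  then show ?thesis
    using has_vector_derivative_continuous[OF Uent_has_vector_derivative] False by simp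
qed (simp add: Uent_l_0)

section \<open>Localization from a negative exponent\<close>

text \<open>Covers short times, where \<open>t powr \<alpha>\<close> with \<alpha> < 0 blows up.
  Terms with \<open>k + 1 < m\<close> vanish, and the others may be weighted by
  \<open>exp (\<mu> * (1 + k - m)) \<ge> 1\<close>.\<close>

lemma cmod_Uent_small_time:
  assumes "0 \<le> \<mu>" "0 \<le> t" "t \<le> 1"
  shows "cmod (Uent lam om t 1 m) \<le> exp \<mu> * exp ((\<bar>lam\<bar> + 2) * exp \<mu>) * exp (- \<mu> * real m)"
proof -
  define B where "B = \<bar>lam\<bar> + 2"
  define f where "f = (\<lambda>k. (- \<i> * of_real t) ^ k / of_nat (fact k) * complex_of_real (Hpow lam om k 1 m))"
  have g: "(\<lambda>k. exp (\<mu> - \<mu> * real m) * ((B * exp \<mu>) ^ k /\<^sub>R fact k)) sums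
      (exp (\<mu> - \<mu> * real m) * exp (B * exp \<mu>))"
    by (intro sums_mult exp_converges)
  have f: "cmod (f k) \<le> exp (\<mu> - \<mu> * real m) * ((B * exp \<mu>) ^ k /\<^sub>R fact k)" for k
  proof (cases "m \<le> k + 1")
    case False
    then have "Hpow lam om k 1 m = 0" by (intro Hpow_eq_0) simp
    then show ?thesis by (simp add: f_def B_def)
  next
    case True
    have "cmod (f k) = t ^ k * \<bar>Hpow lam om k 1 m\<bar> / fact k"
      using assms by (simp add: f_def norm_mult norm_divide norm_power)
    also have "\<dots> \<le> 1 * B ^ k / fact k"
      unfolding B_def using assms
      by (intro divide_right_mono mult_mono abs_Hpow_le power_le_one) auto
    also have "\<dots> \<le> exp (\<mu> * (1 + real k - real m)) * (B ^ k / fact k)"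
      using True assms(1) mult_right_mono[of 1 "exp (\<mu> * (1 + real k - real m))" "B ^ k / fact k"]
      by (simp add: B_def)
    also have "\<dots> = exp (\<mu> - \<mu> * real m) * ((B * exp \<mu>) ^ k /\<^sub>R fact k)"
    proof -
      have "\<mu> * (1 + real k - real m) = (\<mu> - \<mu> * real m) + real k * \<mu>" by (simp add: algebra_simps)
      then show ?thesis
        by (simp only: exp_add exp_of_nat_mult power_mult_distrib) (simp add: divide_inverse)
    qed
    finally show ?thesis .
  qed
  have "cmod (Uent lam om t 1 m) \<le> exp (\<mu> - \<mu> * real m) * exp (B * exp \<mu>)"
    unfolding Uent_def f_def[symmetric] using norm_suminf_le[OF f sums_summable[OF g]] sums_unique[OF g] by simp
  also have "exp (\<mu> - \<mu> * real m) = exp \<mu> * exp (- \<mu> * real m)" by (simp flip: exp_add)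
  finally show ?thesis by (simp add: B_def ac_simps)
qed

text \<open>The decay bounds begin at site 2. At site 1 a phase removes the diagonal term, and the
  derivative is then bounded by the amplitude at site 2. Linear growth is harmless under a Laplace
  transform.\<close>

lemma cmod_Uent_1_1_le:
  assumes "\<And>t. 0 \<le> t \<Longrightarrow> cmod (Uent lam om t 1 2) \<le> C" "0 \<le> t"
  shows "cmod (Uent lam om t 1 1) \<le> 1 + 3 * C * t"
proof -
  define c where "c = \<i> * complex_of_real (fibV lam om 1)"
  define F where "F = (\<lambda>t. exp (c * of_real t) * Uent lam om t 1 1)"
  define F' where "F' = (\<lambda>t. - \<i> * (exp (c * of_real t) * Uent lam om t 1 2))"
  have c: "cmod (exp (c * of_real t)) = 1" for t
    by (simp add: c_def norm_exp_eq_Re)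
  have d: "(F has_vector_derivative F' t) (at t within S)" for t S
    using exp_Uent_has_vector_derivative[of 1 1 c lam om t S]
    by (simp add: F_def F'_def c_def Uent_l_0 algebra_simps numeral_2_eq_2)
  have F': "cmod (F' t) \<le> C" if "0 \<le> t" for t
    using assms(1)[OF that] by (simp only: F'_def norm_mult c norm_minus_cancel norm_ii mult_1)
  \<comment> \<open>The linearization error contributes \<open>2 * C * t\<close>, the linear term
    \<open>C * t\<close>.\<close>
  have "norm (F t - F 0 - (t - 0) *\<^sub>R F' 0) \<le> norm (t - 0) * (2 * C)"
  proof (rule vector_differentiable_bound_linearization[of "{0..t}"])
    fix x assume "x \<in> {0..t}"
    then show "norm (F' x - F' 0) \<le> 2 * C"
      using F'[of x] F'[of 0] norm_triangle_ineq4[of "F' x" "F' 0"] by simp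
  qed (use d assms in \<open>auto simp: closed_segment_eq_real_ivl\<close>)
  then have "cmod (F t - F 0 - t *\<^sub>R F' 0) \<le> t * (2 * C)" using assms(2) by simp
  moreover have "cmod (t *\<^sub>R F' 0) \<le> t * C"
    using F'[of 0] assms(2) by (simp add: mult_left_mono)
  moreover have "cmod (F 0) = 1" by (simp add: F_def Uent_0)
  moreover have "cmod (F t) \<le> cmod (F t - F 0 - t *\<^sub>R F' 0) + cmod (t *\<^sub>R F' 0) + cmod (F 0)"
    by (smt (verit) diff_add_cancel norm_triangle_ineq)
  ultimately have "cmod (F t) \<le> 1 + 3 * C * t" by (simp add: algebra_simps)
  then show ?thesis by (simp only: F_def norm_mult c mult_1)
qed

text \<open>For \<open>t > 1\<close> the factor \<open>t powr \<alpha>\<close> is at most 1, and for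
  \<open>t \<le> 1\<close> the short-time bound applies; \<open>D\<close> adds the two
  constants.\<close>

lemma negative_exponent_imp_localized:
  assumes "\<mu> > 0" "v \<ge> 0" "C > 0" "\<alpha> < 0"
    and U: "\<And>m t. 2 \<le> m \<Longrightarrow> t > 0 \<Longrightarrow>
       cmod (Uent lam om t 1 m) \<le> C * exp (- \<mu> * (real m - v * t powr \<alpha>))"
  shows "\<exists>D>0. \<forall>m\<ge>2. \<forall>t\<ge>0. cmod (Uent lam om t 1 m) \<le> D * exp (- \<mu> * real m)"
proof -
  define D where "D = C * exp (\<mu> * v) + exp \<mu> * exp ((\<bar>lam\<bar> + 2) * exp \<mu>)"
  have "cmod (Uent lam om t 1 m) \<le> D * exp (- \<mu> * real m)" if m: "2 \<le> m" and t: "0 \<le> t" for m t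
  proof (cases "t \<le> 1")
    case True
    have "cmod (Uent lam om t 1 m) \<le> exp \<mu> * exp ((\<bar>lam\<bar> + 2) * exp \<mu>) * exp (- \<mu> * real m)"
      using assms(1) t True by (intro cmod_Uent_small_time) auto
    also have "\<dots> \<le> D * exp (- \<mu> * real m)"
      unfolding D_def using \<open>C > 0\<close> by (intro mult_right_mono) auto
    finally show ?thesis .
  next
    case False
    have "t powr \<alpha> \<le> 1"
      using False powr_mono2'[of "\<alpha>" 1 t] assms(4) by simp
    then have "\<mu> * v * t powr \<alpha> \<le> \<mu> * v"
      using assms by (intro mult_left_le) auto
    then have e: "exp (- \<mu> * (real m - v * t powr \<alpha>)) \<le> exp (\<mu> * v + - \<mu> * real m)"
      by (simp add: algebra_simps)
    then have "C * exp (- \<mu> * (real m - v * t powr \<alpha>)) \<le> C * exp (\<mu> * v) * exp (- \<mu> * real m)"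
      using mult_left_mono[OF e, of C] \<open>C > 0\<close> by (simp only: exp_add mult.assoc less_imp_le)
    also have "\<dots> \<le> D * exp (- \<mu> * real m)"
      unfolding D_def by (intro mult_right_mono) auto
    finally show ?thesis using U[OF m, of t] False by simp
  qed
  moreover have "D > 0" unfolding D_def using \<open>C > 0\<close> by (simp add: add_pos_pos)
  ultimately show ?thesis by blast
qed

section \<open>Laplace transform and Green function\<close>

lemma exp_integral_halfline:
  fixes \<epsilon> :: real
  assumes "\<epsilon> > 0"
  shows "set_integrable lborel {0<..} (\<lambda>t. exp (- \<epsilon> * t))"
    and "(LINT t:{0<..}|lborel. exp (- \<epsilon> * t)) = 1 / \<epsilon>"
proof -
  let ?F = "\<lambda>t. - exp (- \<epsilon> * t) / \<epsilon>"
  have S: "einterval 0 \<infinity> = {0<..}" by (auto simp: einterval_def)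
  have D: "DERIV ?F t :> exp (- \<epsilon> * t)" for t
    using assms by (auto intro!: derivative_eq_intros)
  have "filterlim (\<lambda>t. - \<epsilon> * t) at_bot at_top"
    using assms by (intro filterlim_tendsto_neg_mult_at_bot[OF tendsto_const _ filterlim_ident]) auto
  then have "((\<lambda>t. exp (- \<epsilon> * t)) \<longlongrightarrow> 0) at_top"
    by (rule filterlim_compose[OF exp_at_bot])
  then have "(?F \<longlongrightarrow> - 0 / \<epsilon>) at_top"
    using assms by (intro tendsto_intros) auto
  moreover have "(?F \<longlongrightarrow> ?F 0) (at_right 0)"
    using D[of 0] DERIV_isCont isCont_def filterlim_at_split by blast
  ultimately have lims: "((?F \<circ> real_of_ereal) \<longlongrightarrow> 0) (at_left \<infinity>)"
     "((?F \<circ> real_of_ereal) \<longlongrightarrow> - 1 / \<epsilon>) (at_right 0)"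
    by (simp_all add: ereal_tendsto_simps zero_ereal_def)
  note I = interval_integral_FTC_nonneg[of 0 \<infinity> ?F "\<lambda>t. exp (- \<epsilon> * t)" "- 1 / \<epsilon>" 0, OF _ D _ _ lims(2) lims(1)]
  show "set_integrable lborel {0<..} (\<lambda>t. exp (- \<epsilon> * t))"
    using I(1) unfolding S by simp
  show "(LINT t:{0<..}|lborel. exp (- \<epsilon> * t)) = 1 / \<epsilon>"
    using I(2) unfolding interval_lebesgue_integral_def S by simp
qed

lemma laplace_integrable:
  fixes f :: "real \<Rightarrow> complex"
  assumes "\<epsilon> > 0" "\<And>t. isCont f t" "\<And>t. 0 < t \<Longrightarrow> cmod (f t) \<le> K * exp (- \<epsilon> * t)"
  shows "set_integrable lborel {0<..} f" "cmod (LINT t:{0<..}|lborel. f t) \<le> K / \<epsilon>"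
proof -
  have K: "set_integrable lborel {0<..} (\<lambda>t. K * exp (- \<epsilon> * t))"
    using exp_integral_halfline(1)[OF assms(1)] by simp
  have "f \<in> borel_measurable borel"
    using assms(2) by (intro borel_measurable_continuous_onI) (simp add: continuous_at_imp_continuous_on)
  then have "set_borel_measurable lborel {0<..} f"
    unfolding set_borel_measurable_def by measurable
  then show f: "set_integrable lborel {0<..} f"
    using assms(3) by (intro set_integrable_bound[OF K])
      (auto intro!: AE_I2 order_trans[OF _ abs_ge_self])
  have "cmod (LINT t:{0<..}|lborel. f t) \<le> (LINT t:{0<..}|lborel. cmod (f t))"
    unfolding set_lebesgue_integral_def
    by (rule order_trans[OF integral_norm_bound]) (simp add: norm_scaleR)
  also have "\<dots> \<le> (LINT t:{0<..}|lborel. K * exp (- \<epsilon> * t))"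
    using assms(3) by (intro set_integral_mono K set_integrable_norm f) auto
  also have "\<dots> = K / \<epsilon>" using exp_integral_halfline(2)[OF assms(1)] by simp
  finally show "cmod (LINT t:{0<..}|lborel. f t) \<le> K / \<epsilon>" .
qed

lemma halfline_FTC:
  fixes F :: "real \<Rightarrow> complex"
  assumes "\<And>t. (F has_vector_derivative f t) (at t)" "\<And>t. isCont f t"
    and "set_integrable lborel {0<..} f" "(F \<longlongrightarrow> 0) at_top"
  shows "(LINT t:{0<..}|lborel. f t) = - F 0"
proof -
  have S: "einterval 0 \<infinity> = {0<..}" by (auto simp: einterval_def)
  have "(F \<longlongrightarrow> F 0) (at_right 0)"
    using has_vector_derivative_continuous[OF assms(1)[of 0]]
    by (meson continuous_within filterlim_at_split)
  then have "(LBINT t=0..\<infinity>. f t) = 0 - F 0"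
    using assms by (intro interval_integral_FTC_integrable)
      (simp_all add: ereal_tendsto_simps zero_ereal_def S[unfolded zero_ereal_def])
  then show ?thesis unfolding interval_lebesgue_integral_def S by simp
qed

text \<open>The Laplace transform of the amplitudes is the Green function of the half-line operator at the
  spectral parameter \<^term>\<open>z\<close>; the source at site 1 is traded for the value \<^term>\<open>\<i>\<close> at site 0.\<close>
lemma localized_imp_decaying_solution:
  assumes U: "\<And>m t. 2 \<le> m \<Longrightarrow> 0 \<le> t \<Longrightarrow> cmod (Uent lam om t 1 m) \<le> D * exp (- \<mu> * real m)"
    and "Im z > 0" "D > 0"
  shows "\<exists>u. u 0 = \<i> \<and> (\<forall>k\<ge>1. u (k + 1) + u (k - 1) + of_real (fibV lam om k) * u k = z * u k) \<and>
    (\<forall>m\<ge>2. cmod (u m) \<le> D * exp (- \<mu> * real m) / Im z)"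
proof -
  define \<epsilon> where "\<epsilon> = Im z"
  have \<epsilon>: "\<epsilon> > 0" using assms by (simp add: \<epsilon>_def)
  define G where "G = (\<lambda>m t. exp (\<i> * z * of_real t) * Uent lam om t 1 m)"
  define S where "S = {0::real<..}"
  define g where "g = (\<lambda>m. LINT t:S|lborel. G m t)"
  have cont: "isCont (G m) t" for m t
    unfolding G_def by (intro continuous_intros continuous_Uent) auto
  have cmodG: "cmod (G m t) = exp (- \<epsilon> * t) * cmod (Uent lam om t 1 m)" for m t
    by (simp add: G_def norm_mult norm_exp_eq_Re \<epsilon>_def)
  have large: "cmod (G m t) \<le> D * exp (- \<mu> * real m) * exp (- \<epsilon> * t)" if "2 \<le> m" "0 \<le> t" for m t
    unfolding cmodG using U[OF that] by (simp add: mult.commute)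
  \<comment> \<open>Half of the damping rate is spent on the linear growth at site 1.\<close>
  have "\<exists>K. \<forall>t\<ge>0. cmod (G m t) \<le> K * exp (- (\<epsilon> / 2) * t)" for m
  proof -
    consider "m = 0" | "m = 1" | "2 \<le> m" by linarith
    then show ?thesis
    proof cases
      case 1
      then show ?thesis by (intro exI[of _ 0]) (simp add: G_def Uent_l_0)
    next
      case 2
      define C where "C = D * exp (- \<mu> * real 2)"
      have C: "C \<ge> 0" using \<open>D > 0\<close> by (simp add: C_def)
      have "cmod (G 1 t) \<le> (1 + 6 * C / \<epsilon>) * exp (- (\<epsilon> / 2) * t)" if t: "0 \<le> t" for t
      proof -
        have "cmod (Uent lam om t 1 1) \<le> 1 + 3 * C * t"
          using U[of 2] by (intro cmod_Uent_1_1_le t) (simp_all add: C_def)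
        also have "\<dots> = 1 + 6 * C / \<epsilon> * (\<epsilon> / 2 * t)" using \<epsilon> by simp
        also have "\<dots> \<le> 1 * exp (\<epsilon> / 2 * t) + 6 * C / \<epsilon> * exp (\<epsilon> / 2 * t)"
        proof (intro add_mono mult_left_mono)
          show "\<epsilon> / 2 * t \<le> exp (\<epsilon> / 2 * t)"
            using exp_ge_add_one_self[of "\<epsilon> / 2 * t"] by linarith
        qed (use C \<epsilon> t in auto)
        finally have "cmod (G 1 t) \<le> exp (- \<epsilon> * t) * ((1 + 6 * C / \<epsilon>) * exp (\<epsilon> / 2 * t))"
          unfolding cmodG by (intro mult_left_mono) (auto simp: algebra_simps)
        also have "\<dots> = (1 + 6 * C / \<epsilon>) * exp (- \<epsilon> * t + \<epsilon> / 2 * t)"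
          by (simp only: exp_add ac_simps)
        finally show ?thesis by (simp add: algebra_simps)
      qed
      then show ?thesis using 2 by blast
    next
      case 3
      have "cmod (G m t) \<le> D * exp (- \<mu> * real m) * exp (- (\<epsilon> / 2) * t)" if t: "0 \<le> t" for t
      proof (rule order_trans[OF large[OF 3 t]])
        show "D * exp (- \<mu> * real m) * exp (- \<epsilon> * t) \<le> D * exp (- \<mu> * real m) * exp (- (\<epsilon> / 2) * t)"
          using \<epsilon> t \<open>D > 0\<close> by (intro mult_left_mono) auto
      qed
      then show ?thesis by blast
    qed
  qed
  then obtain K where K: "\<And>m t. 0 \<le> t \<Longrightarrow> cmod (G m t) \<le> K m * exp (- (\<epsilon> / 2) * t)" by metis
  have int: "set_integrable lborel S (G m)" for m
    unfolding S_def using \<epsilon> cont K by (intro laplace_integrable(1)[of "\<epsilon> / 2" _ "K m"]) auto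
  have lim: "(G m \<longlongrightarrow> 0) at_top" for m
  proof (rule Lim_null_comparison)
    show "\<forall>\<^sub>F t in at_top. norm (G m t) \<le> K m * exp (- (\<epsilon> / 2) * t)"
      using eventually_ge_at_top[of 0] by eventually_elim (rule K)
    have "filterlim (\<lambda>t. - (\<epsilon> / 2) * t) at_bot at_top"
      using \<epsilon> by (intro filterlim_tendsto_neg_mult_at_bot[OF tendsto_const _ filterlim_ident]) auto
    from filterlim_compose[OF exp_at_bot this]
    show "((\<lambda>t. K m * exp (- (\<epsilon> / 2) * t)) \<longlongrightarrow> 0) at_top"
      by (rule tendsto_mult_right_zero)
  qed
  \<comment> \<open>Integrating the derivative of \<open>G k\<close> leaves minus its initial value,
    which is the source at site 1.\<close>
  have eq: "g (k + 1) + g (k - 1) + of_real (fibV lam om k) * g k - z * g k = (if k = 1 then - \<i> else 0)"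
    if k: "1 \<le> k" for k
  proof -
    define f where "f = (\<lambda>t. \<i> * (z * G k t - (G (k + 1) t + G (k - 1) t + of_real (fibV lam om k) * G k t)))"
    have int': "set_integrable lborel S (\<lambda>t. c * G m t)" for c m
    proof (cases "c = 0")
      case True
      then show ?thesis by (simp add: set_integrable_def)
    qed (use int in \<open>intro set_integrable_mult_right\<close>)
    have "(G k has_vector_derivative f t) (at t)" for t
      using exp_Uent_has_vector_derivative[OF _ k, of 1 "\<i> * z" lam om t UNIV]
      unfolding G_def f_def by (simp add: algebra_simps)
    moreover have "isCont f t" for t
      unfolding f_def by (intro continuous_intros cont)
    moreover have "set_integrable lborel S f"
      unfolding f_def by (intro set_integrable_mult_right set_integral_diff(1) set_integral_add(1) int int')
    ultimately have "(LINT t:S|lborel. f t) = - G k 0"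
      unfolding S_def using lim by (intro halfline_FTC) auto
    moreover have "(LINT t:S|lborel. f t) =
        \<i> * (z * g k - (g (k + 1) + g (k - 1) + of_real (fibV lam om k) * g k))"
      unfolding f_def g_def by (simp add: set_integral_diff(2) set_integral_add int int')
    moreover have "G k 0 = (if k = 1 then 1 else 0)"
      by (simp add: G_def Uent_0)
    ultimately have "\<i> * (z * g k - (g (k + 1) + g (k - 1) + of_real (fibV lam om k) * g k)) =
       (if k = 1 then - 1 else 0)" by simp
    then have "\<i> * (\<i> * (z * g k - (g (k + 1) + g (k - 1) + of_real (fibV lam om k) * g k))) =
       \<i> * (if k = 1 then - 1 else 0)" by simp
    then show ?thesis by (simp add: mult.assoc[symmetric] split: if_splits) 
  qed
  have g0: "g 0 = 0" by (simp add: g_def G_def Uent_l_0)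
  \<comment> \<open>Changing the value 0 at site 0 to \<i> cancels the source -\<i> at site 1; no
    equation with \<open>k > 1\<close> sees site 0.\<close>
  define u where "u = (\<lambda>k. if k = 0 then \<i> else g k)"
  have "u (k + 1) + u (k - 1) + of_real (fibV lam om k) * u k = z * u k" if "1 \<le> k" for k
    using eq[OF that] that g0 by (cases "k = 1") (auto simp: u_def algebra_simps)
  moreover have "cmod (u m) \<le> D * exp (- \<mu> * real m) / \<epsilon>" if m: "2 \<le> m" for m
  proof -
    have "cmod (g m) \<le> D * exp (- \<mu> * real m) / \<epsilon>"
      unfolding g_def S_def using \<epsilon> cont large[OF m] by (intro laplace_integrable(2)) auto
    then show ?thesis using m by (simp add: u_def)
  qed
  ultimately show ?thesis by (intro exI[of _ u]) (auto simp: u_def \<epsilon>_def)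
qed

section \<open>Contradiction with localization\<close>

lemma quadratic_exponent_not_ge_exponential:
  fixes a L \<mu> :: real
  assumes "\<mu> > 0" "L \<ge> 0"
  shows "\<exists>K\<ge>1. a + real ((2 * K + 3) * (2 * K + 2)) * L < \<mu> * 2 ^ K"
proof -
  have "(\<lambda>K. real K / sqrt 2 ^ K) \<longlonglongrightarrow> 0"
    using lim_n_over_pown[of "sqrt 2"] by simp
  then have "(\<lambda>K. a * (1 / 2) ^ K + 20 * L * (real K / sqrt 2 ^ K)\<^sup>2) \<longlonglongrightarrow> a * 0 + 20 * L * 0\<^sup>2"
    by (intro tendsto_intros LIMSEQ_power_zero) auto
  then have "\<forall>\<^sub>F K in sequentially. a * (1 / 2) ^ K + 20 * L * (real K / sqrt 2 ^ K)\<^sup>2 < \<mu>"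
    using assms by (intro order_tendstoD(2)) auto
  then obtain K where K: "K \<ge> 1" "a * (1 / 2) ^ K + 20 * L * (real K / sqrt 2 ^ K)\<^sup>2 < \<mu>"
    using eventually_happens'[OF sequentially_bot eventually_conj[OF _ eventually_ge_at_top[of 1]]]
    by blast
  have s: "(sqrt 2 ^ K)\<^sup>2 = (2::real) ^ K"
    by (simp flip: power_mult add: mult.commute[of K] power_mult)
  have "a * (1 / 2) ^ K + 20 * L * (real K / sqrt 2 ^ K)\<^sup>2 = (a + 20 * (real K)\<^sup>2 * L) / 2 ^ K"
    by (simp add: power_divide s add_divide_distrib ac_simps)
  then have "a + 20 * (real K)\<^sup>2 * L < \<mu> * 2 ^ K"
    using K(2) by (simp add: pos_divide_less_eq)
  \<comment> \<open>20 = 4 + 10 + 6 sums the coefficients of the quadratic, as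
    \<open>K \<ge> 1\<close>.\<close>
  moreover have "real ((2 * K + 3) * (2 * K + 2)) * L \<le> 20 * (real K)\<^sup>2 * L"
  proof (rule mult_right_mono[OF _ assms(2)])
    have k: "1 \<le> real K" using K(1) by simp
    then have "1 * real K \<le> real K * real K" by (intro mult_right_mono) auto
    moreover have "real ((2 * K + 3) * (2 * K + 2)) = 4 * (real K * real K) + 10 * real K + 6"
      by (simp add: algebra_simps)
    ultimately show "real ((2 * K + 3) * (2 * K + 2)) \<le> 20 * (real K)\<^sup>2"
      unfolding power2_eq_square using k by linarith
  qed
  ultimately show ?thesis using K(1) by (intro exI[of _ K]) linarith
qed

lemma LR_imp_nonneg:
  assumes "lam > 0" and LR: "LR lam om \<alpha>"
  shows "\<alpha> \<ge> 0"
proof (rule ccontr)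
  assume "\<not> \<alpha> \<ge> 0"
  then obtain D \<mu> where D: "D > 0" "\<mu> > 0"
    and loc: "\<And>m t. 2 \<le> m \<Longrightarrow> 0 \<le> t \<Longrightarrow> cmod (Uent lam om t 1 m) \<le> D * exp (- \<mu> * real m)"
    using LR_imp_Uent_le[OF LR] negative_exponent_imp_localized[of _ _ _ \<alpha> lam om] by (metis not_le)
  \<comment> \<open>A common base above 2, \<open>lam + 8\<close> and \<open>2 * lam + 14\<close>
    merges all factors into one power.\<close>
  define R where "R = 2 * lam + 16"
  have R: "R > 1" "2 \<le> R" "lam + 7 + 1 \<le> R" "2 * lam + 14 \<le> R" using \<open>lam > 0\<close> by (auto simp: R_def)
  have bound: "1 \<le> 2 * D * R ^ ((2 * K + 3) * (2 * K + 2)) * exp (- \<mu> * 2 ^ K)" if "K \<ge> 1" for K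
  proof -
    \<comment> \<open>The entry bounds at level \<open>K\<close> use traces up to index
      \<open>2 * K + 3\<close>, which fixes the distance of \<open>z\<close> from the axis.\<close>
    obtain z where z: "Im z = 1 / (2 * lam + 14) ^ (2 * K + 3)"
      "\<And>n. n \<le> 2 * K + 3 \<Longrightarrow> cmod (fib_trace (of_real lam) z n) \<le> lam + 7"
      using bounded_fib_trace_off_axis[OF \<open>lam > 0\<close>] by blast
    define b where "b = (2 * (lam + 7 + 1) ^ (2 * K + 2)) ^ (2 * K + 1)"
    obtain P where P: "P \<ge> 2 ^ K" "entries_le (tprod z (fibV lam om) 1 P) b"
      unfolding b_def using transfer_subexponential[OF _ z(2)] \<open>lam > 0\<close> by auto
    have "(2::nat) ^ 1 \<le> 2 ^ K" using that by (intro power_increasing) auto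
    with P have P2: "2 \<le> P" by simp
    have Im: "Im z > 0" using \<open>lam > 0\<close> by (simp add: z)
    obtain u where u: "u 0 = \<i>"
        "\<And>k. 1 \<le> k \<Longrightarrow> u (k + 1) + u (k - 1) + of_real (fibV lam om k) * u k = z * u k"
        "\<And>m. 2 \<le> m \<Longrightarrow> cmod (u m) \<le> D * exp (- \<mu> * real m) / Im z"
      using localized_imp_decaying_solution[OF loc Im D(1)] by blast
    have uP: "cmod (u m) \<le> D * exp (- \<mu> * 2 ^ K) / Im z" if "P \<le> m" for m
    proof (rule order_trans[OF u(3)])
      have "(2::real) ^ K \<le> real m" using P(1) that by (metis of_nat_le_iff of_nat_numeral of_nat_power order_trans)
      then show "D * exp (- \<mu> * real m) / Im z \<le> D * exp (- \<mu> * 2 ^ K) / Im z"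
        using D Im by (intro divide_right_mono mult_left_mono) auto
    qed (use P2 that in simp)
    have b: "0 \<le> b" "b \<le> (R * R ^ (2 * K + 2)) ^ (2 * K + 1)"
      unfolding b_def using R \<open>lam > 0\<close> by (simp, intro power_mono mult_mono) auto
    have "1 = cmod (u 0)" by (simp add: u)
    also have "\<dots> \<le> b * (cmod (u (P + 1)) + cmod (u P))"
      by (rule solution_le[OF u(2) P(2)])
    also have "\<dots> \<le> b * (D * exp (- \<mu> * 2 ^ K) / Im z + D * exp (- \<mu> * 2 ^ K) / Im z)"
      by (intro mult_left_mono add_mono uP b(1)) auto
    also have "\<dots> = 2 * D * (b * (2 * lam + 14) ^ (2 * K + 3)) * exp (- \<mu> * 2 ^ K)"
      by (simp add: z)
    also have "\<dots> \<le> 2 * D * ((R * R ^ (2 * K + 2)) ^ (2 * K + 1) * R ^ (2 * K + 3)) * exp (- \<mu> * 2 ^ K)"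
      using b D R \<open>lam > 0\<close> by (intro mult_right_mono mult_left_mono mult_mono power_mono) auto
    also have "(R * R ^ (2 * K + 2)) ^ (2 * K + 1) * R ^ (2 * K + 3) = R ^ ((2 * K + 3) * (2 * K + 2))"
    proof -
      have "R * R ^ (2 * K + 2) = R ^ (2 * K + 3)" by (simp add: power3_eq_cube power_add)
      then have "(R * R ^ (2 * K + 2)) ^ (2 * K + 1) * R ^ (2 * K + 3) = R ^ ((2 * K + 3) * (2 * K + 1) + (2 * K + 3))"
        by (simp only: power_mult power_add)
      also have "(2 * K + 3) * (2 * K + 1) + (2 * K + 3) = (2 * K + 3) * (2 * K + 2)" by simp
      finally show ?thesis .
    qed
    finally show ?thesis .
  qed
  have "0 \<le> ln (2 * D) + real ((2 * K + 3) * (2 * K + 2)) * ln R - \<mu> * 2 ^ K" if "K \<ge> 1" for K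
  proof -
    have "ln 1 \<le> ln (2 * D * R ^ ((2 * K + 3) * (2 * K + 2)) * exp (- \<mu> * 2 ^ K))"
      by (intro ln_mono bound that) auto
    also have "\<dots> = ln (2 * D) + real ((2 * K + 3) * (2 * K + 2)) * ln R - \<mu> * 2 ^ K"
      using D R by (simp add: ln_mult ln_realpow del: of_nat_mult of_nat_add)
    finally show ?thesis by simp
  qed
  moreover obtain K where "K \<ge> 1" "ln (2 * D) + real ((2 * K + 3) * (2 * K + 2)) * ln R < \<mu> * 2 ^ K"
    using quadratic_exponent_not_ge_exponential[OF D(2), of "ln R" "ln (2 * D)"] R by auto
  ultimately show False by (smt (verit))
qed

theorem theorem2p6:
  fixes lam om \<alpha> :: real
  assumes "lam > 0" and "0 \<le> om" and "om < 1"
    and "LR lam om \<alpha>"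
  shows "ereal \<alpha> \<ge> alpha_u_plus lam om"
  unfolding alpha_u_plus_def
proof (rule Sup_least)
  fix x assume "x \<in> ereal ` {\<beta>. \<beta> \<ge> 0 \<and> Splus lam om \<beta> < \<infinity>}"
  then obtain \<beta> where x: "x = ereal \<beta>" "\<beta> \<ge> 0" "Splus lam om \<beta> \<noteq> \<infinity>" by auto
  have "\<beta> \<le> \<alpha>"
  proof (rule ccontr)
    assume "\<not> \<beta> \<le> \<alpha>"
    \<comment> \<open>Excluding \<alpha> < 0 makes \<beta> strictly positive, as
      \<open>Splus_eq_infinity\<close> requires; this also settles \<beta> = 0.\<close>
    then have "\<beta> > \<alpha>" "\<beta> > 0" using LR_imp_nonneg[OF assms(1,4)] by auto
    then have "Splus lam om \<beta> = \<infinity>"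
      using LR_imp_Uent_le[OF assms(4)] Splus_eq_infinity by metis
    with x show False by simp
  qed
  then show "x \<le> ereal \<alpha>" by (simp add: x)
qed

end
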